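(* Let $R$ be a commutative ring, let $M$ and $N$ be $R$-modules, and let $x\in\operatorname{Ann}(N)$ be an $M$-regular element. Then $$\operatorname{depth}(N,M/xM)+1=\operatorname{depth}(N,M).$$
   Context: For $R$-modules $N,M$, $\operatorname{depth}(N,M)\in\mathbb{N}\cup\{\infty\}$ is the least $i$ with $\operatorname{Ext}^i_R(N,M)\neq 0$ (and $\infty$ if there is no such $i$), with $\infty+1=\infty$. An element $x\in R$ is $M$-regular if multiplication by $x$ on $M$ is injective. $\operatorname{Ann}(N)$ is the annihilator of $N$. *)

theory Defs
  imports "HOL-Library.Extended_Nat" "HOL-Algebra.AbelCoset" "HOL-Algebra.Module"
begin

text \<open>
  Modules are those of \<^theory>\<open>HOL-Algebra.Module\<close>. Their record type extends that of rings,
  so it has the fields \<open>mult\<close> and \<open>one\<close>; these play no role for a module and are left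
  \<open>undefined\<close> below.
\<close>

section \<open>Quotient modules and modules of homomorphisms\<close>

definition quotient_module :: "('r, 'm, 'd) module_scheme \<Rightarrow> 'm set \<Rightarrow> ('r, 'm set) module"
  where "quotient_module M H =
    \<lparr>carrier = a_rcosets\<^bsub>M\<^esub> H, mult = undefined, one = undefined,
     zero = H, add = set_add M,
     smult = (\<lambda>a X. \<Union>m\<in>X. H +>\<^bsub>M\<^esub> (a \<odot>\<^bsub>M\<^esub> m))\<rparr>"

definition mod_hom ::
    "('r, 'k) ring_scheme \<Rightarrow> ('r, 'p, 'c) module_scheme \<Rightarrow> ('r, 'm, 'd) module_scheme \<Rightarrow> ('p \<Rightarrow> 'm) set"
  where "mod_hom R P M =
    {\<phi> \<in> carrier P \<rightarrow> carrier M.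
      (\<forall>p\<in>carrier P. \<forall>q\<in>carrier P. \<phi> (p \<oplus>\<^bsub>P\<^esub> q) = \<phi> p \<oplus>\<^bsub>M\<^esub> \<phi> q) \<and>
      (\<forall>a\<in>carrier R. \<forall>p\<in>carrier P. \<phi> (a \<odot>\<^bsub>P\<^esub> p) = a \<odot>\<^bsub>M\<^esub> \<phi> p)}"

text \<open>
  Homomorphisms are taken to be \<^const>\<open>extensional\<close>, so that two of them are equal iff they
  agree on the carrier.
\<close>

definition Hom_module ::
    "('r, 'k) ring_scheme \<Rightarrow> ('r, 'p, 'c) module_scheme \<Rightarrow> ('r, 'm, 'd) module_scheme
      \<Rightarrow> ('r, 'p \<Rightarrow> 'm) module"
  where "Hom_module R P M =
    \<lparr>carrier = mod_hom R P M \<inter> extensional (carrier P), mult = undefined, one = undefined,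
     zero = (\<lambda>p\<in>carrier P. \<zero>\<^bsub>M\<^esub>),
     add = (\<lambda>\<phi> \<psi>. \<lambda>p\<in>carrier P. \<phi> p \<oplus>\<^bsub>M\<^esub> \<psi> p),
     smult = (\<lambda>a \<phi>. \<lambda>p\<in>carrier P. a \<odot>\<^bsub>M\<^esub> \<phi> p)\<rparr>"

lemma module_Hom_module:
  assumes "Module.module R P" "Module.module R M" shows "Module.module R (Hom_module R P M)"
proof -
  interpret P: Module.module R P by fact
  interpret M: Module.module R M by fact
  have car: "\<phi> p \<in> carrier M" if "\<phi> \<in> carrier (Hom_module R P M)" "p \<in> carrier P" for \<phi> p
    using that by (auto simp: Hom_module_def mod_hom_def)
  have ag: "abelian_group (Hom_module R P M)"
  proof (rule abelian_groupI)
    fix \<phi> assume \<phi>: "\<phi> \<in> carrier (Hom_module R P M)"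
    have "(\<lambda>p\<in>carrier P. \<ominus>\<^bsub>M\<^esub> \<phi> p) \<in> carrier (Hom_module R P M)"
      using \<phi> by (auto simp: Hom_module_def mod_hom_def M.minus_add M.smult_r_minus Pi_iff M.a_comm)
    moreover have "(\<lambda>p\<in>carrier P. \<ominus>\<^bsub>M\<^esub> \<phi> p) \<oplus>\<^bsub>Hom_module R P M\<^esub> \<phi> = \<zero>\<^bsub>Hom_module R P M\<^esub>"
      using \<phi> car[OF \<phi>] by (auto simp: Hom_module_def M.l_neg intro!: restrict_ext)
    ultimately show "\<exists>g\<in>carrier (Hom_module R P M). g \<oplus>\<^bsub>Hom_module R P M\<^esub> \<phi> = \<zero>\<^bsub>Hom_module R P M\<^esub>"
      by blast
  next
    fix \<phi> assume \<phi>: "\<phi> \<in> carrier (Hom_module R P M)"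
    show "\<zero>\<^bsub>Hom_module R P M\<^esub> \<oplus>\<^bsub>Hom_module R P M\<^esub> \<phi> = \<phi>"
      using \<phi> car[OF \<phi>] by (auto simp: Hom_module_def intro!: extensionalityI[of _ "carrier P"])
  qed (auto simp: Hom_module_def mod_hom_def Pi_iff M.a_ac M.smult_r_distr intro!: restrict_ext)
  show ?thesis
  proof (rule moduleI[OF P.is_cring ag])
    fix \<phi> assume \<phi>: "\<phi> \<in> carrier (Hom_module R P M)"
    show "\<one>\<^bsub>R\<^esub> \<odot>\<^bsub>Hom_module R P M\<^esub> \<phi> = \<phi>"
      using \<phi> car[OF \<phi>] by (auto simp: Hom_module_def intro!: extensionalityI[of _ "carrier P"])
  next
    fix a \<phi> assume a: "a \<in> carrier R" and \<phi>: "\<phi> \<in> carrier (Hom_module R P M)"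
    have "a \<odot>\<^bsub>M\<^esub> (b \<odot>\<^bsub>M\<^esub> m) = b \<odot>\<^bsub>M\<^esub> (a \<odot>\<^bsub>M\<^esub> m)" if "b \<in> carrier R" "m \<in> carrier M" for b m
      using that a by (metis M.smult_assoc1 P.m_comm)
    then show "a \<odot>\<^bsub>Hom_module R P M\<^esub> \<phi> \<in> carrier (Hom_module R P M)"
      using a \<phi> by (auto simp: Hom_module_def mod_hom_def Pi_iff M.smult_r_distr)
  qed (auto simp: Hom_module_def mod_hom_def Pi_iff M.smult_r_distr M.smult_l_distr M.smult_assoc1
        intro!: restrict_ext)
qed

lemma quotient_smult_coset:
  assumes "Module.module R M" "submodule H R M" "a \<in> carrier R" "m \<in> carrier M"
  shows "a \<odot>\<^bsub>quotient_module M H\<^esub> (H +>\<^bsub>M\<^esub> m) = H +>\<^bsub>M\<^esub> (a \<odot>\<^bsub>M\<^esub> m)"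
proof -
  interpret Module.module R M by fact
  interpret H: submodule H R M by fact
  have sub: "subgroup H (add_monoid M)" by (rule H.subgroup_axioms)
  have HM: "H \<subseteq> carrier M" using submoduleE(1)[OF assms(2)] .
  have coset: "y \<in> H +>\<^bsub>M\<^esub> k \<longleftrightarrow> (\<exists>h\<in>H. y = h \<oplus>\<^bsub>M\<^esub> k)" for y k
    unfolding a_r_coset_def' by blast
  have eq: "H +>\<^bsub>M\<^esub> (a \<odot>\<^bsub>M\<^esub> y) = H +>\<^bsub>M\<^esub> (a \<odot>\<^bsub>M\<^esub> m)" if y: "y \<in> H +>\<^bsub>M\<^esub> m" for y
  proof -
    obtain h where h: "h \<in> H" "y = h \<oplus>\<^bsub>M\<^esub> m" using y coset by blast
    have "a \<odot>\<^bsub>M\<^esub> y = a \<odot>\<^bsub>M\<^esub> h \<oplus>\<^bsub>M\<^esub> a \<odot>\<^bsub>M\<^esub> m"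
      unfolding h(2) using h(1) HM assms(3,4) by (intro smult_r_distr) auto
    moreover have "a \<odot>\<^bsub>M\<^esub> h \<in> H" using h assms(3) by (intro H.smult_closed)
    ultimately have "a \<odot>\<^bsub>M\<^esub> y \<in> H +>\<^bsub>M\<^esub> (a \<odot>\<^bsub>M\<^esub> m)" using coset by blast
    then show ?thesis
      using M.a_repr_independence[OF _ smult_closed[OF assms(3,4)] sub] by simp
  qed
  have "m \<in> H +>\<^bsub>M\<^esub> m"
    using coset[of m m] subgroup.one_closed[OF sub] M.l_zero[OF assms(4)] by force
  then have "(\<Union>k\<in>H +>\<^bsub>M\<^esub> m. H +>\<^bsub>M\<^esub> (a \<odot>\<^bsub>M\<^esub> k)) = H +>\<^bsub>M\<^esub> (a \<odot>\<^bsub>M\<^esub> m)"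
    using eq by blast
  then show ?thesis by (simp add: quotient_module_def)
qed

lemma module_quotient_module:
  assumes "Module.module R M" "submodule H R M"
  shows "Module.module R (quotient_module M H)"
proof -
  interpret Module.module R M by fact
  interpret H: submodule H R M by fact
  have sub: "subgroup H (add_monoid M)" by (rule H.subgroup_axioms)
  have HM: "H \<subseteq> carrier M" using submoduleE(1)[OF assms(2)] .
  interpret S: abelian_subgroup H M
    by (rule abelian_subgroupI3)
      (use sub in \<open>auto simp: additive_subgroup_def intro: abelian_group_axioms\<close>)
  have car: "carrier (quotient_module M H) = (\<lambda>m. H +>\<^bsub>M\<^esub> m) ` carrier M"
    by (auto simp: quotient_module_def A_RCOSETS_def')
  have add: "(H +>\<^bsub>M\<^esub> m) \<oplus>\<^bsub>quotient_module M H\<^esub> (H +>\<^bsub>M\<^esub> m') = H +>\<^bsub>M\<^esub> (m \<oplus>\<^bsub>M\<^esub> m')"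
    if "m \<in> carrier M" "m' \<in> carrier M" for m m'
    using S.a_rcos_sum[OF that] by (simp add: quotient_module_def)
  have zero: "\<zero>\<^bsub>quotient_module M H\<^esub> = H +>\<^bsub>M\<^esub> \<zero>\<^bsub>M\<^esub>"
    using HM by (simp add: quotient_module_def)
  note sm = quotient_smult_coset[OF assms]
  have ag: "abelian_group (quotient_module M H)"
  proof (rule abelian_groupI)
    fix X assume "X \<in> carrier (quotient_module M H)"
    then obtain m where m: "m \<in> carrier M" "X = H +>\<^bsub>M\<^esub> m" using car by auto
    then have "(H +>\<^bsub>M\<^esub> (\<ominus>\<^bsub>M\<^esub> m)) \<oplus>\<^bsub>quotient_module M H\<^esub> X = \<zero>\<^bsub>quotient_module M H\<^esub>"
      by (simp add: add zero M.l_neg)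
    then show "\<exists>Y\<in>carrier (quotient_module M H). Y \<oplus>\<^bsub>quotient_module M H\<^esub> X = \<zero>\<^bsub>quotient_module M H\<^esub>"
      using m car by blast
  qed (auto simp: car add zero M.a_ac)
  show ?thesis
    by (rule moduleI[OF is_cring ag])
      (auto simp: car add sm smult_l_distr smult_r_distr smult_assoc1)
qed


section \<open>Free modules and free resolutions\<close>

definition free_module :: "('r, 'k) ring_scheme \<Rightarrow> 'b set \<Rightarrow> ('r, 'b \<Rightarrow> 'r) module"
  where "free_module R B =
    \<lparr>carrier = {f. range f \<subseteq> carrier R \<and> finite {b. f b \<noteq> \<zero>\<^bsub>R\<^esub>} \<and> {b. f b \<noteq> \<zero>\<^bsub>R\<^esub>} \<subseteq> B},
     mult = undefined, one = undefined,
     zero = (\<lambda>_. \<zero>\<^bsub>R\<^esub>),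
     add = (\<lambda>f g b. f b \<oplus>\<^bsub>R\<^esub> g b),
     smult = (\<lambda>a f b. a \<otimes>\<^bsub>R\<^esub> f b)\<rparr>"

lemma module_free_module:
  fixes R :: "('r, 'k) ring_scheme" and B :: "'b set"
  assumes "cring R" shows "Module.module R (free_module R B)"
proof -
  interpret cring R by fact
  have car: "f b \<in> carrier R" if "range f \<subseteq> carrier R" for f :: "'b \<Rightarrow> 'r" and b
    using that by auto
  have ag: "abelian_group (free_module R B)"
  proof (rule abelian_groupI)
    fix f g assume f: "f \<in> carrier (free_module R B)" and g: "g \<in> carrier (free_module R B)"
    have "{b. f b \<oplus>\<^bsub>R\<^esub> g b \<noteq> \<zero>\<^bsub>R\<^esub>} \<subseteq> {b. f b \<noteq> \<zero>\<^bsub>R\<^esub>} \<union> {b. g b \<noteq> \<zero>\<^bsub>R\<^esub>}" by auto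
    then show "f \<oplus>\<^bsub>free_module R B\<^esub> g \<in> carrier (free_module R B)"
      using f g by (auto simp: free_module_def car intro: finite_subset)
  next
    fix f assume f: "f \<in> carrier (free_module R B)"
    have "(\<lambda>b. \<ominus>\<^bsub>R\<^esub> f b) \<in> carrier (free_module R B)"
    proof -
      have "{b. \<ominus>\<^bsub>R\<^esub> f b \<noteq> \<zero>\<^bsub>R\<^esub>} \<subseteq> {b. f b \<noteq> \<zero>\<^bsub>R\<^esub>}" by auto
      then show ?thesis using f by (auto simp: free_module_def car intro: finite_subset)
    qed
    moreover have "(\<lambda>b. \<ominus>\<^bsub>R\<^esub> f b) \<oplus>\<^bsub>free_module R B\<^esub> f = \<zero>\<^bsub>free_module R B\<^esub>"
      using f by (auto simp: free_module_def car l_neg)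
    ultimately show "\<exists>g\<in>carrier (free_module R B). g \<oplus>\<^bsub>free_module R B\<^esub> f = \<zero>\<^bsub>free_module R B\<^esub>"
      by blast
  qed (auto simp: free_module_def car a_ac)
  show ?thesis
  proof (rule moduleI[OF assms ag])
    fix a f assume a: "a \<in> carrier R" and f: "f \<in> carrier (free_module R B)"
    have "{b. a \<otimes>\<^bsub>R\<^esub> f b \<noteq> \<zero>\<^bsub>R\<^esub>} \<subseteq> {b. f b \<noteq> \<zero>\<^bsub>R\<^esub>}" using a by auto
    then show "a \<odot>\<^bsub>free_module R B\<^esub> f \<in> carrier (free_module R B)"
      using a f by (auto simp: free_module_def car intro: finite_subset)
  qed (auto simp: free_module_def car l_distr r_distr m_assoc)
qed

definition lin_comb ::
    "('r, 'k) ring_scheme \<Rightarrow> ('r, 'm, 'd) module_scheme \<Rightarrow> ('b \<Rightarrow> 'm) \<Rightarrow> ('b \<Rightarrow> 'r) \<Rightarrow> 'm"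
  where "lin_comb R M e f = (\<Oplus>\<^bsub>M\<^esub>b\<in>{b. f b \<noteq> \<zero>\<^bsub>R\<^esub>}. f b \<odot>\<^bsub>M\<^esub> e b)"

definition is_basis ::
    "('r, 'k) ring_scheme \<Rightarrow> ('r, 'm, 'd) module_scheme \<Rightarrow> 'b set \<Rightarrow> ('b \<Rightarrow> 'm) \<Rightarrow> bool"
  where "is_basis R M B e \<longleftrightarrow>
    e \<in> B \<rightarrow> carrier M \<and> bij_betw (lin_comb R M e) (carrier (free_module R B)) (carrier M)"

text \<open>
  \<open>\<dots> \<rightarrow> P 2 \<rightarrow> P 1 \<rightarrow> P 0 \<rightarrow> N \<rightarrow> 0\<close> is exact, with differentials \<open>d i : P (i + 1) \<rightarrow> P i\<close> and
  augmentation \<open>\<epsilon> : P 0 \<rightarrow> N\<close>, and \<open>P i\<close> is free on the family \<open>e i\<close> indexed by \<open>B i\<close>.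
\<close>

definition free_resolution ::
    "('r, 'k) ring_scheme \<Rightarrow> ('r, 'n, 'd) module_scheme \<Rightarrow> (nat \<Rightarrow> ('r, 'p) module) \<Rightarrow>
      (nat \<Rightarrow> 'p \<Rightarrow> 'p) \<Rightarrow> ('p \<Rightarrow> 'n) \<Rightarrow> (nat \<Rightarrow> 'b set) \<Rightarrow> (nat \<Rightarrow> 'b \<Rightarrow> 'p) \<Rightarrow> bool"
  where "free_resolution R N P d \<epsilon> B e \<longleftrightarrow>
    (\<forall>i. Module.module R (P i) \<and> is_basis R (P i) (B i) (e i)) \<and>
    (\<forall>i. d i \<in> mod_hom R (P (Suc i)) (P i)) \<and>
    \<epsilon> \<in> mod_hom R (P 0) N \<and>
    \<epsilon> ` carrier (P 0) = carrier N \<and>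
    d 0 ` carrier (P 1) = {p \<in> carrier (P 0). \<epsilon> p = \<zero>\<^bsub>N\<^esub>} \<and>
    (\<forall>i. d (Suc i) ` carrier (P (Suc (Suc i))) = {p \<in> carrier (P (Suc i)). d i p = \<zero>\<^bsub>P i\<^esub>})"


section \<open>A canonical free resolution\<close>

text \<open>
  Every module \<open>N\<close> has a canonical free resolution: \<open>P 0\<close> is free on the elements of \<open>N\<close>, and
  \<open>P (i + 1)\<close> is free on the formal linear combinations of generators of \<open>P i\<close> that
  map to zero under \<open>P i \<rightarrow> P (i - 1)\<close> (respectively under \<open>P 0 \<rightarrow> N\<close>). Such formal combinations
  are represented by lists, which may contain repeated generators and zero coefficients; this only
  makes the generating set of the kernel redundant, and it allows the generators of all the \<open>P i\<close>
  to live in a free_gen type.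
\<close>

datatype ('r, 'n) syz = Elt 'n | Rel "('r \<times> ('r, 'n) syz) list"

fun formal_sum :: "('r, 'k) ring_scheme \<Rightarrow> ('r \<times> 'b) list \<Rightarrow> 'b \<Rightarrow> 'r"
  where
    "formal_sum R [] = (\<lambda>_. \<zero>\<^bsub>R\<^esub>)"
  | "formal_sum R ((a, b) # L) = (\<lambda>c. (if c = b then a else \<zero>\<^bsub>R\<^esub>) \<oplus>\<^bsub>R\<^esub> formal_sum R L c)"

definition std_res_aug ::
    "('r, 'k) ring_scheme \<Rightarrow> ('r, 'n, 'd) module_scheme \<Rightarrow> (('r, 'n) syz \<Rightarrow> 'r) \<Rightarrow> 'n"
  where "std_res_aug R N = lin_comb R N (\<lambda>g. case g of Elt n \<Rightarrow> n | Rel L \<Rightarrow> \<zero>\<^bsub>N\<^esub>)"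

definition syz_bd :: "('r, 'k) ring_scheme \<Rightarrow> ('r, 'n) syz \<Rightarrow> ('r, 'n) syz \<Rightarrow> 'r"
  where "syz_bd R g = (case g of Elt n \<Rightarrow> \<lambda>_. \<zero>\<^bsub>R\<^esub> | Rel L \<Rightarrow> formal_sum R L)"

fun std_res_gens ::
    "('r, 'k) ring_scheme \<Rightarrow> ('r, 'n, 'd) module_scheme \<Rightarrow> nat \<Rightarrow> ('r, 'n) syz set"
  where
    "std_res_gens R N 0 = Elt ` carrier N"
  | "std_res_gens R N (Suc 0) =
      Rel ` {L \<in> lists (carrier R \<times> std_res_gens R N 0). std_res_aug R N (formal_sum R L) = \<zero>\<^bsub>N\<^esub>}"
  | "std_res_gens R N (Suc (Suc i)) =
      Rel ` {L \<in> lists (carrier R \<times> std_res_gens R N (Suc i)).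
        lin_comb R (free_module R (std_res_gens R N i)) (syz_bd R) (formal_sum R L) = (\<lambda>_. \<zero>\<^bsub>R\<^esub>)}"

definition std_res ::
    "('r, 'k) ring_scheme \<Rightarrow> ('r, 'n, 'd) module_scheme \<Rightarrow> nat \<Rightarrow> ('r, ('r, 'n) syz \<Rightarrow> 'r) module"
  where "std_res R N i = free_module R (std_res_gens R N i)"

definition std_res_d ::
    "('r, 'k) ring_scheme \<Rightarrow> ('r, 'n, 'd) module_scheme \<Rightarrow> nat \<Rightarrow>
      (('r, 'n) syz \<Rightarrow> 'r) \<Rightarrow> (('r, 'n) syz \<Rightarrow> 'r)"
  where "std_res_d R N i = lin_comb R (std_res R N i) (syz_bd R)"

lemma lin_comb_superset:
  assumes "Module.module R M" "f \<in> A \<rightarrow> carrier R" "e \<in> A \<rightarrow> carrier M"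
    "finite A" "{b. f b \<noteq> \<zero>\<^bsub>R\<^esub>} \<subseteq> A"
  shows "lin_comb R M e f = (\<Oplus>\<^bsub>M\<^esub>b\<in>A. f b \<odot>\<^bsub>M\<^esub> e b)"
proof -
  interpret Module.module R M by fact
  show ?thesis unfolding lin_comb_def
    by (rule M.add.finprod_mono_neutral_cong_left) (use assms in \<open>auto simp: Pi_iff\<close>)
qed

lemma free_moduleD:
  assumes "f \<in> carrier (free_module R B)"
  shows "f b \<in> carrier R" "finite {b. f b \<noteq> \<zero>\<^bsub>R\<^esub>}" "{b. f b \<noteq> \<zero>\<^bsub>R\<^esub>} \<subseteq> B"
  using assms by (auto simp: free_module_def)

lemma lin_comb_mod_hom:
  assumes "Module.module R M" "e \<in> B \<rightarrow> carrier M"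
  shows "lin_comb R M e \<in> mod_hom R (free_module R B) M"
proof -
  interpret Module.module R M by fact
  have closed: "lin_comb R M e f \<in> carrier M" if "f \<in> carrier (free_module R B)" for f
    unfolding lin_comb_def
    by (rule M.finsum_closed) (use free_moduleD[OF that] assms(2) in \<open>auto simp: Pi_iff\<close>)
  have add: "lin_comb R M e (f \<oplus>\<^bsub>free_module R B\<^esub> g) = lin_comb R M e f \<oplus>\<^bsub>M\<^esub> lin_comb R M e g"
    if f: "f \<in> carrier (free_module R B)" and g: "g \<in> carrier (free_module R B)" for f g
  proof -
    let ?A = "{b. f b \<noteq> \<zero>\<^bsub>R\<^esub>} \<union> {b. g b \<noteq> \<zero>\<^bsub>R\<^esub>}"
    note ff = free_moduleD[OF f] and gg = free_moduleD[OF g]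
    have e: "e \<in> ?A \<rightarrow> carrier M" using assms(2) ff gg by auto
    have fin: "finite ?A" using ff gg by auto
    have "lin_comb R M e (\<lambda>b. f b \<oplus>\<^bsub>R\<^esub> g b) = (\<Oplus>\<^bsub>M\<^esub>b\<in>?A. (f b \<oplus>\<^bsub>R\<^esub> g b) \<odot>\<^bsub>M\<^esub> e b)"
      by (rule lin_comb_superset) (use ff gg e fin in \<open>auto intro: module_axioms\<close>)
    also have "\<dots> = (\<Oplus>\<^bsub>M\<^esub>b\<in>?A. f b \<odot>\<^bsub>M\<^esub> e b \<oplus>\<^bsub>M\<^esub> g b \<odot>\<^bsub>M\<^esub> e b)"
      by (rule M.add.finprod_cong) (use e ff gg in \<open>auto simp: smult_l_distr Pi_iff simp_implies_def\<close>)
    also have "\<dots> = (\<Oplus>\<^bsub>M\<^esub>b\<in>?A. f b \<odot>\<^bsub>M\<^esub> e b) \<oplus>\<^bsub>M\<^esub> (\<Oplus>\<^bsub>M\<^esub>b\<in>?A. g b \<odot>\<^bsub>M\<^esub> e b)"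
      by (rule M.finsum_addf) (use e ff gg in \<open>auto simp: Pi_iff\<close>)
    also have "(\<Oplus>\<^bsub>M\<^esub>b\<in>?A. f b \<odot>\<^bsub>M\<^esub> e b) = lin_comb R M e f"
      by (rule lin_comb_superset[symmetric]) (use ff e fin in \<open>auto intro: module_axioms\<close>)
    also have "(\<Oplus>\<^bsub>M\<^esub>b\<in>?A. g b \<odot>\<^bsub>M\<^esub> e b) = lin_comb R M e g"
      by (rule lin_comb_superset[symmetric]) (use gg e fin in \<open>auto intro: module_axioms\<close>)
    finally show ?thesis by (simp add: free_module_def)
  qed
  have smult: "lin_comb R M e (a \<odot>\<^bsub>free_module R B\<^esub> f) = a \<odot>\<^bsub>M\<^esub> lin_comb R M e f"
    if a: "a \<in> carrier R" and f: "f \<in> carrier (free_module R B)" for a f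
  proof -
    let ?A = "{b. f b \<noteq> \<zero>\<^bsub>R\<^esub>}"
    note ff = free_moduleD[OF f]
    have e: "e \<in> ?A \<rightarrow> carrier M" using assms(2) ff by auto
    have "lin_comb R M e (\<lambda>b. a \<otimes>\<^bsub>R\<^esub> f b) = (\<Oplus>\<^bsub>M\<^esub>b\<in>?A. (a \<otimes>\<^bsub>R\<^esub> f b) \<odot>\<^bsub>M\<^esub> e b)"
      by (rule lin_comb_superset) (use ff e a in \<open>auto intro: module_axioms\<close>)
    also have "\<dots> = (\<Oplus>\<^bsub>M\<^esub>b\<in>?A. a \<odot>\<^bsub>M\<^esub> (f b \<odot>\<^bsub>M\<^esub> e b))"
      by (rule M.add.finprod_cong) (use e ff a in \<open>auto simp: smult_assoc1 Pi_iff simp_implies_def\<close>)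
    also have "\<dots> = a \<odot>\<^bsub>M\<^esub> (\<Oplus>\<^bsub>M\<^esub>b\<in>?A. f b \<odot>\<^bsub>M\<^esub> e b)"
      by (rule finsum_smult_ldistr[symmetric]) (use e ff a in \<open>auto simp: Pi_iff\<close>)
    finally show ?thesis by (simp add: free_module_def lin_comb_def)
  qed
  show ?thesis using closed add smult by (auto simp: mod_hom_def)
qed

lemma mod_hom_finsum:
  assumes "Module.module R P" "Module.module R M" "\<phi> \<in> mod_hom R P M"
    "finite A" "f \<in> A \<rightarrow> carrier P"
  shows "\<phi> (\<Oplus>\<^bsub>P\<^esub>b\<in>A. f b) = (\<Oplus>\<^bsub>M\<^esub>b\<in>A. \<phi> (f b))"
proof -
  interpret P: Module.module R P by fact
  interpret M: Module.module R M by fact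
  have \<phi>: "\<phi> p \<in> carrier M" if "p \<in> carrier P" for p
    using that assms(3) by (auto simp: mod_hom_def)
  have "\<phi> (\<zero>\<^bsub>R\<^esub> \<odot>\<^bsub>P\<^esub> \<zero>\<^bsub>P\<^esub>) = \<zero>\<^bsub>R\<^esub> \<odot>\<^bsub>M\<^esub> \<phi> \<zero>\<^bsub>P\<^esub>"
    using assms(3) unfolding mod_hom_def by blast
  then have zero: "\<phi> \<zero>\<^bsub>P\<^esub> = \<zero>\<^bsub>M\<^esub>" using \<phi> by simp
  show ?thesis using assms(4,5)
  proof (induction A)
    case (insert a A)
    then have "(\<Oplus>\<^bsub>P\<^esub>b\<in>A. f b) \<in> carrier P" "f a \<in> carrier P" by auto
    then show ?case using insert assms(3) \<phi> by (auto simp: mod_hom_def Pi_iff)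
  qed (simp add: zero)
qed

lemma mod_hom_zero:
  assumes "Module.module R P" "Module.module R M" "\<phi> \<in> mod_hom R P M"
  shows "\<phi> \<zero>\<^bsub>P\<^esub> = \<zero>\<^bsub>M\<^esub>"
proof -
  interpret P: Module.module R P by fact
  interpret M: Module.module R M by fact
  show ?thesis using mod_hom_finsum[OF assms, of "{}" "\<lambda>b. b"] by simp
qed

lemma mod_hom_lin_comb:
  assumes "Module.module R P" "Module.module R M" "\<phi> \<in> mod_hom R P M"
    "e \<in> B \<rightarrow> carrier P" "f \<in> carrier (free_module R B)"
  shows "\<phi> (lin_comb R P e f) = lin_comb R M (\<lambda>b. \<phi> (e b)) f"
proof -
  interpret P: Module.module R P by fact
  interpret M: Module.module R M by fact
  note ff = free_moduleD[OF assms(5)]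
  have "\<phi> (lin_comb R P e f) = (\<Oplus>\<^bsub>M\<^esub>b\<in>{b. f b \<noteq> \<zero>\<^bsub>R\<^esub>}. \<phi> (f b \<odot>\<^bsub>P\<^esub> e b))"
    unfolding lin_comb_def
    by (rule mod_hom_finsum[OF assms(1-3)]) (use ff assms(4) in \<open>auto simp: Pi_iff\<close>)
  also have "\<dots> = lin_comb R M (\<lambda>b. \<phi> (e b)) f" unfolding lin_comb_def
    by (rule M.add.finprod_cong)
      (use ff assms(3,4) in \<open>auto simp: Pi_iff mod_hom_def simp_implies_def\<close>)
  finally show ?thesis .
qed

definition free_gen :: "('r, 'k) ring_scheme \<Rightarrow> 'b \<Rightarrow> 'b \<Rightarrow> 'r"
  where "free_gen R b = (\<lambda>c. if c = b then \<one>\<^bsub>R\<^esub> else \<zero>\<^bsub>R\<^esub>)"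

lemma free_gen_closed:
  assumes "cring R" "b \<in> B" shows "free_gen R b \<in> carrier (free_module R B)"
proof -
  interpret cring R by fact
  have "{c. free_gen R b c \<noteq> \<zero>\<^bsub>R\<^esub>} \<subseteq> {b}" by (auto simp: free_gen_def)
  then show ?thesis using assms(2)
    by (auto simp: free_module_def free_gen_def intro: finite_subset)
qed

lemma lin_comb_free_gen:
  assumes "Module.module R M" "e b \<in> carrier M" shows "lin_comb R M e (free_gen R b) = e b"
proof -
  interpret Module.module R M by fact
  have "lin_comb R M e (free_gen R b) = (\<Oplus>\<^bsub>M\<^esub>c\<in>{b}. free_gen R b c \<odot>\<^bsub>M\<^esub> e c)"
    by (rule lin_comb_superset[OF assms(1)]) (use assms in \<open>auto simp: free_gen_def\<close>)
  also have "\<dots> = e b" using assms(2) by (simp add: free_gen_def)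
  finally show ?thesis .
qed

lemma free_module_finsum_apply:
  assumes "cring R" "finite A" "F \<in> A \<rightarrow> carrier (free_module R B)"
  shows "(\<Oplus>\<^bsub>free_module R B\<^esub>b\<in>A. F b) c = (\<Oplus>\<^bsub>R\<^esub>b\<in>A. F b c)"
proof -
  interpret cring R by fact
  interpret F: Module.module R "free_module R B" by (rule module_free_module[OF assms(1)])
  show ?thesis using assms(2,3)
  proof (induction A)
    case empty
    then show ?case unfolding F.finsum_empty finsum_empty by (simp add: free_module_def)
  next
    case (insert a A)
    then show ?case using free_moduleD(1)[where R = R and B = B]
      by (subst F.finsum_insert, auto simp: Pi_iff) (simp add: free_module_def Pi_iff)
  qed
qed

lemma is_basis_free_module:
  assumes "cring R" shows "is_basis R (free_module R B) B (free_gen R)"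
proof -
  interpret cring R by fact
  have "lin_comb R (free_module R B) (free_gen R) f = f" if f: "f \<in> carrier (free_module R B)" for f
  proof
    fix c
    interpret F: Module.module R "free_module R B" by (rule module_free_module[OF assms(1)])
    note ff = free_moduleD[OF f]
    let ?A = "insert c {b. f b \<noteq> \<zero>\<^bsub>R\<^esub>}"
    have "lin_comb R (free_module R B) (free_gen R) f c
        = (\<Oplus>\<^bsub>R\<^esub>b\<in>{b. f b \<noteq> \<zero>\<^bsub>R\<^esub>}. (f b \<odot>\<^bsub>free_module R B\<^esub> free_gen R b) c)"
      unfolding lin_comb_def
      by (rule free_module_finsum_apply[OF assms])
        (use ff free_gen_closed[OF assms, where B = B] in auto)
    also have "\<dots> = (\<Oplus>\<^bsub>R\<^esub>b\<in>?A. if c = b then f b else \<zero>\<^bsub>R\<^esub>)"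
      by (rule add.finprod_mono_neutral_cong_left)
        (use ff in \<open>auto simp: free_module_def free_gen_def simp_implies_def\<close>)
    also have "\<dots> = f c" by (rule add.finprod_singleton) (use ff in auto)
    finally show "lin_comb R (free_module R B) (free_gen R) f c = f c" .
  qed
  then have "bij_betw (lin_comb R (free_module R B) (free_gen R))
      (carrier (free_module R B)) (carrier (free_module R B))"
    using bij_betw_cong[of "carrier (free_module R B)" _ id] bij_betw_id by fastforce
  then show ?thesis using free_gen_closed[OF assms] by (auto simp: is_basis_def)
qed

lemma formal_sum_closed:
  assumes "cring R" "L \<in> lists (carrier R \<times> B)"
  shows "formal_sum R L \<in> carrier (free_module R B)"
proof -
  interpret cring R by fact
  interpret F: Module.module R "free_module R B" by (rule module_free_module[OF assms(1)])
  show ?thesis using assms(2)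
  proof (induction L)
    case Nil
    show ?case by (simp add: free_module_def)
  next
    case (Cons p L)
    obtain a b where p: "p = (a, b)" "a \<in> carrier R" "b \<in> B" using Cons by auto
    have "formal_sum R (p # L)
        = (a \<odot>\<^bsub>free_module R B\<^esub> free_gen R b) \<oplus>\<^bsub>free_module R B\<^esub> formal_sum R L"
      using p by (auto simp: free_module_def free_gen_def)
    moreover have "formal_sum R L \<in> carrier (free_module R B)" using Cons by simp
    moreover have "a \<odot>\<^bsub>free_module R B\<^esub> free_gen R b \<in> carrier (free_module R B)"
      using p free_gen_closed[OF assms(1)] by (intro F.smult_closed)
    ultimately show ?case by (simp only: F.a_closed)
  qed
qed

lemma formal_sum_surj:
  assumes "cring R" "f \<in> carrier (free_module R B)"
  obtains L where "L \<in> lists (carrier R \<times> B)" "formal_sum R L = f"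
proof -
  interpret cring R by fact
  note ff = free_moduleD[OF assms(2)]
  obtain bs where bs: "set bs = {b. f b \<noteq> \<zero>\<^bsub>R\<^esub>}" "distinct bs"
    using finite_distinct_list[OF ff(2)] by auto
  have "formal_sum R (map (\<lambda>b. (f b, b)) bs) c = (if c \<in> set bs then f c else \<zero>\<^bsub>R\<^esub>)" for c
    using bs(2) by (induction bs) (auto simp: ff)
  then have "formal_sum R (map (\<lambda>b. (f b, b)) bs) = f" using bs by auto
  moreover have "map (\<lambda>b. (f b, b)) bs \<in> lists (carrier R \<times> B)" using ff bs by auto
  ultimately show ?thesis using that by blast
qed

text \<open>Adjoining formal relations as generators makes the sequence exact.\<close>

lemma exact_step:
  assumes "cring R" "Module.module R M" "\<phi> \<in> mod_hom R (free_module R B) M"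
    "C = Rel ` {L \<in> lists (carrier R \<times> B). \<phi> (formal_sum R L) = \<zero>\<^bsub>M\<^esub>}"
  shows "syz_bd R \<in> C \<rightarrow> carrier (free_module R B)"
    and "lin_comb R (free_module R B) (syz_bd R) ` carrier (free_module R C)
      = {p \<in> carrier (free_module R B). \<phi> p = \<zero>\<^bsub>M\<^esub>}"
proof -
  interpret Module.module R M by fact
  interpret F: Module.module R "free_module R B" by (rule module_free_module[OF assms(1)])
  show bd: "syz_bd R \<in> C \<rightarrow> carrier (free_module R B)"
  proof
    fix g assume "g \<in> C"
    then obtain L where "g = Rel L" "L \<in> lists (carrier R \<times> B)" unfolding assms(4) by blast
    then show "syz_bd R g \<in> carrier (free_module R B)"
      using formal_sum_closed[OF assms(1)] by (simp add: syz_bd_def)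
  qed
  let ?d = "lin_comb R (free_module R B) (syz_bd R)"
  have d: "?d \<in> mod_hom R (free_module R C) (free_module R B)"
    by (rule lin_comb_mod_hom[OF F.module_axioms bd])
  show "?d ` carrier (free_module R C) = {p \<in> carrier (free_module R B). \<phi> p = \<zero>\<^bsub>M\<^esub>}"
  proof (intro equalityI subsetI)
    fix p assume "p \<in> ?d ` carrier (free_module R C)"
    then obtain f where f: "f \<in> carrier (free_module R C)" "p = ?d f" by blast
    have "\<phi> p = lin_comb R M (\<lambda>b. \<phi> (syz_bd R b)) f"
      unfolding f(2) by (rule mod_hom_lin_comb[OF F.module_axioms assms(2,3) bd f(1)])
    also have "\<dots> = \<zero>\<^bsub>M\<^esub>" unfolding lin_comb_def
    proof (rule M.add.finprod_one_eqI)
      fix b assume "b \<in> {b. f b \<noteq> \<zero>\<^bsub>R\<^esub>}"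
      then have "b \<in> C" using free_moduleD[OF f(1)] by auto
      then have "\<phi> (syz_bd R b) = \<zero>\<^bsub>M\<^esub>" by (auto simp: assms(4) syz_bd_def)
      then show "f b \<odot>\<^bsub>M\<^esub> \<phi> (syz_bd R b) = \<zero>\<^bsub>M\<^esub>" using free_moduleD[OF f(1)] by simp
    qed
    finally show "p \<in> {p \<in> carrier (free_module R B). \<phi> p = \<zero>\<^bsub>M\<^esub>}"
      using d f by (auto simp: mod_hom_def)
  next
    fix p assume p: "p \<in> {p \<in> carrier (free_module R B). \<phi> p = \<zero>\<^bsub>M\<^esub>}"
    then obtain L where L: "L \<in> lists (carrier R \<times> B)" "formal_sum R L = p"
      using formal_sum_surj[OF assms(1)] by blast
    then have C: "Rel L \<in> C" using p by (auto simp: assms(4))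
    have "?d (free_gen R (Rel L)) = p"
      using lin_comb_free_gen[where e = "syz_bd R" and b = "Rel L", OF F.module_axioms funcset_mem[OF bd C]] L
      by (simp add: syz_bd_def)
    then show "p \<in> ?d ` carrier (free_module R C)" using free_gen_closed[OF assms(1) C] by blast
  qed
qed

lemma free_resolution_std_res:
  assumes "Module.module R N"
  shows "free_resolution R N (std_res R N) (std_res_d R N) (std_res_aug R N) (std_res_gens R N) (\<lambda>_. free_gen R)"
proof -
  interpret N: Module.module R N by fact
  have mod: "Module.module R (std_res R N i)" for i
    unfolding std_res_def by (rule module_free_module[OF N.is_cring])
  let ?e = "\<lambda>g. case g of Elt n \<Rightarrow> n | Rel L \<Rightarrow> \<zero>\<^bsub>N\<^esub>"
  have aug: "std_res_aug R N \<in> mod_hom R (std_res R N 0) N"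
    unfolding std_res_aug_def std_res_def by (rule lin_comb_mod_hom[OF assms]) auto
  have z: "\<zero>\<^bsub>std_res R N i\<^esub> = (\<lambda>_. \<zero>\<^bsub>R\<^esub>)" for i by (simp add: std_res_def free_module_def)
  note step0 = exact_step[OF N.is_cring assms aug[unfolded std_res_def] std_res_gens.simps(2)]
  have bd: "syz_bd R \<in> std_res_gens R N (Suc i) \<rightarrow> carrier (std_res R N i)" for i
  proof (induction i)
    case 0
    show ?case using step0(1) by (simp add: std_res_def)
  next
    case (Suc i)
    have "std_res_d R N i \<in> mod_hom R (free_module R (std_res_gens R N (Suc i))) (std_res R N i)"
      unfolding std_res_d_def by (rule lin_comb_mod_hom[OF mod Suc])
    from exact_step(1)[OF N.is_cring mod this, of "std_res_gens R N (Suc (Suc i))"]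
    show ?case by (simp add: std_res_d_def std_res_def z[unfolded std_res_def])
  qed
  have d: "std_res_d R N i \<in> mod_hom R (std_res R N (Suc i)) (std_res R N i)" for i
    unfolding std_res_d_def using lin_comb_mod_hom[OF mod bd] by (simp add: std_res_def)
  have d': "std_res_d R N i \<in> mod_hom R (free_module R (std_res_gens R N (Suc i))) (std_res R N i)" for i
    using d[of i] by (simp add: std_res_def[of R N "Suc i"])
  have ex: "std_res_d R N (Suc i) ` carrier (std_res R N (Suc (Suc i)))
      = {p \<in> carrier (std_res R N (Suc i)). std_res_d R N i p = \<zero>\<^bsub>std_res R N i\<^esub>}" for i
    using exact_step(2)[OF N.is_cring mod[of i] d', of "std_res_gens R N (Suc (Suc i))"]
    by (simp add: std_res_d_def std_res_def z[unfolded std_res_def])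
  have ex0: "std_res_d R N 0 ` carrier (std_res R N 1) = {p \<in> carrier (std_res R N 0). std_res_aug R N p = \<zero>\<^bsub>N\<^esub>}"
    using step0(2) by (simp add: std_res_d_def std_res_def)
  have surj: "std_res_aug R N ` carrier (std_res R N 0) = carrier N"
  proof (intro equalityI subsetI)
    fix n assume n: "n \<in> carrier N"
    then have "std_res_aug R N (free_gen R (Elt n)) = n"
      unfolding std_res_aug_def by (subst lin_comb_free_gen[OF assms]) auto
    then show "n \<in> std_res_aug R N ` carrier (std_res R N 0)"
      using free_gen_closed[OF N.is_cring, of "Elt n" "std_res_gens R N 0"] n
      by (auto simp: std_res_def image_iff intro!: bexI)
  qed (use aug in \<open>auto simp: mod_hom_def\<close>)
  have basis: "is_basis R (std_res R N i) (std_res_gens R N i) (free_gen R)" for i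
    unfolding std_res_def by (rule is_basis_free_module[OF N.is_cring])
  show ?thesis unfolding free_resolution_def
    using mod basis d aug surj ex0 ex by blast
qed


section \<open>Ext, annihilators, regular elements and depth\<close>

definition codiff :: "(nat \<Rightarrow> ('r, 'p) module) \<Rightarrow> (nat \<Rightarrow> 'p \<Rightarrow> 'p) \<Rightarrow> nat \<Rightarrow> ('p \<Rightarrow> 'm) \<Rightarrow> 'p \<Rightarrow> 'm"
  where "codiff P d i \<phi> = (\<lambda>p\<in>carrier (P (Suc i)). \<phi> (d i p))"

definition cocycles ::
    "('r, 'k) ring_scheme \<Rightarrow> (nat \<Rightarrow> ('r, 'p) module) \<Rightarrow> (nat \<Rightarrow> 'p \<Rightarrow> 'p) \<Rightarrow>
      ('r, 'm, 'd) module_scheme \<Rightarrow> nat \<Rightarrow> ('p \<Rightarrow> 'm) set"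
  where "cocycles R P d M i =
    {\<phi> \<in> carrier (Hom_module R (P i) M). codiff P d i \<phi> = \<zero>\<^bsub>Hom_module R (P (Suc i)) M\<^esub>}"

fun coboundaries ::
    "('r, 'k) ring_scheme \<Rightarrow> (nat \<Rightarrow> ('r, 'p) module) \<Rightarrow> (nat \<Rightarrow> 'p \<Rightarrow> 'p) \<Rightarrow>
      ('r, 'm, 'd) module_scheme \<Rightarrow> nat \<Rightarrow> ('p \<Rightarrow> 'm) set"
  where
    "coboundaries R P d M 0 = {\<zero>\<^bsub>Hom_module R (P 0) M\<^esub>}"
  | "coboundaries R P d M (Suc i) = codiff P d i ` carrier (Hom_module R (P i) M)"

text \<open>The cohomology of the complex \<open>Hom(P 0, M) \<rightarrow> Hom(P 1, M) \<rightarrow> \<dots>\<close>, as a module.\<close>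

definition cohomology ::
    "('r, 'k) ring_scheme \<Rightarrow> (nat \<Rightarrow> ('r, 'p) module) \<Rightarrow> (nat \<Rightarrow> 'p \<Rightarrow> 'p) \<Rightarrow>
      ('r, 'm, 'd) module_scheme \<Rightarrow> nat \<Rightarrow> ('r, ('p \<Rightarrow> 'm) set) module"
  where "cohomology R P d M i =
    quotient_module ((Hom_module R (P i) M)\<lparr>carrier := cocycles R P d M i\<rparr>)
      (coboundaries R P d M i)"

text \<open>
  Ext is computed from the canonical free resolution of \<open>N\<close>; any other projective resolution gives
  an isomorphic module.
\<close>

definition Ext ::
    "('r, 'k) ring_scheme \<Rightarrow> ('r, 'n, 'c) module_scheme \<Rightarrow> ('r, 'm, 'd) module_scheme \<Rightarrow> nat \<Rightarrow>
      ('r, ((('r, 'n) syz \<Rightarrow> 'r) \<Rightarrow> 'm) set) module"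
  where "Ext R N M i = cohomology R (std_res R N) (std_res_d R N) M i"

definition depth ::
    "('r, 'k) ring_scheme \<Rightarrow> ('r, 'n, 'c) module_scheme \<Rightarrow> ('r, 'm, 'd) module_scheme \<Rightarrow> enat"
  where "depth R N M =
    (if \<exists>i. carrier (Ext R N M i) \<noteq> {\<zero>\<^bsub>Ext R N M i\<^esub>}
     then enat (LEAST i. carrier (Ext R N M i) \<noteq> {\<zero>\<^bsub>Ext R N M i\<^esub>}) else \<infinity>)"

definition annihilator :: "('r, 'k) ring_scheme \<Rightarrow> ('r, 'n, 'd) module_scheme \<Rightarrow> 'r set"
  where "annihilator R N = {a \<in> carrier R. \<forall>n\<in>carrier N. a \<odot>\<^bsub>N\<^esub> n = \<zero>\<^bsub>N\<^esub>}"

definition regular_elt :: "('r, 'k) ring_scheme \<Rightarrow> ('r, 'm, 'd) module_scheme \<Rightarrow> 'r \<Rightarrow> bool"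
  where "regular_elt R M x \<longleftrightarrow> x \<in> carrier R \<and> inj_on (\<lambda>m. x \<odot>\<^bsub>M\<^esub> m) (carrier M)"

definition smult_image :: "'r \<Rightarrow> ('r, 'm, 'd) module_scheme \<Rightarrow> 'm set"
  where "smult_image x M = (\<lambda>m. x \<odot>\<^bsub>M\<^esub> m) ` carrier M"

lemma submodule_smult_image:
  assumes "Module.module R M" "x \<in> carrier R"
  shows "submodule (smult_image x M) R M"
proof -
  interpret Module.module R M by fact
  show ?thesis
  proof (rule submoduleI)
    show "smult_image x M \<subseteq> carrier M" using assms(2) by (auto simp: smult_image_def)
    show "\<zero>\<^bsub>M\<^esub> \<in> smult_image x M"
      using assms(2) by (auto simp: smult_image_def image_iff intro!: bexI[of _ "\<zero>\<^bsub>M\<^esub>"])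
    fix a assume "a \<in> smult_image x M"
    then show "\<ominus>\<^bsub>M\<^esub> a \<in> smult_image x M"
      using assms(2) by (auto simp: smult_image_def image_iff smult_r_minus[symmetric])
  next
    fix a b assume "a \<in> smult_image x M" "b \<in> smult_image x M"
    then show "a \<oplus>\<^bsub>M\<^esub> b \<in> smult_image x M"
      using assms(2) by (auto simp: smult_image_def image_iff smult_r_distr[symmetric])
  next
    fix a b assume a: "a \<in> carrier R" and "b \<in> smult_image x M"
    then obtain m where m: "m \<in> carrier M" "b = x \<odot>\<^bsub>M\<^esub> m" by (auto simp: smult_image_def)
    have "a \<odot>\<^bsub>M\<^esub> b = x \<odot>\<^bsub>M\<^esub> (a \<odot>\<^bsub>M\<^esub> m)"
      using m a assms(2) by (metis smult_assoc1 R.m_comm)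
    then show "a \<odot>\<^bsub>M\<^esub> b \<in> smult_image x M" using m a by (auto simp: smult_image_def)
  qed
qed

end

theory Submission
  imports Defs
begin

text \<open>
  Multiplication by \<open>x\<close> on a free resolution \<open>P\<close> of \<open>N\<close> is null-homotopic because \<open>x\<close> kills \<open>N\<close>.
  Hence \<open>x\<close> kills \<open>Ext i (N, M)\<close>, and the long exact sequence of \<open>0 \<rightarrow> M \<rightarrow> M \<rightarrow> M / x M \<rightarrow> 0\<close>
  breaks into short exact sequences
  \<open>0 \<rightarrow> Ext i (N, M) \<rightarrow> Ext i (N, M / x M) \<rightarrow> Ext (i + 1) (N, M) \<rightarrow> 0\<close>. Together with
  \<open>Ext 0 (N, M) = 0\<close> this shifts the first non-vanishing index by one. The two vanishing statements
  actually needed are obtained by chasing cocycles.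
\<close>

section \<open>Homomorphisms\<close>

lemma (in abelian_group) minus_eq_zero_iff:
  assumes "a \<in> carrier G" "b \<in> carrier G" shows "a \<ominus> b = \<zero> \<longleftrightarrow> a = b"
  using assms by (metis a_minus_def add.inv_closed minus_equality minus_minus r_neg)

lemma mod_homD:
  assumes "\<phi> \<in> mod_hom R P M"
  shows "p \<in> carrier P \<Longrightarrow> \<phi> p \<in> carrier M"
    and "p \<in> carrier P \<Longrightarrow> q \<in> carrier P \<Longrightarrow> \<phi> (p \<oplus>\<^bsub>P\<^esub> q) = \<phi> p \<oplus>\<^bsub>M\<^esub> \<phi> q"
    and "a \<in> carrier R \<Longrightarrow> p \<in> carrier P \<Longrightarrow> \<phi> (a \<odot>\<^bsub>P\<^esub> p) = a \<odot>\<^bsub>M\<^esub> \<phi> p"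
  using assms by (auto simp: mod_hom_def)

lemma mod_hom_minus:
  assumes "Module.module R P" "Module.module R M" "\<phi> \<in> mod_hom R P M"
    "p \<in> carrier P" "q \<in> carrier P"
  shows "\<phi> (p \<ominus>\<^bsub>P\<^esub> q) = \<phi> p \<ominus>\<^bsub>M\<^esub> \<phi> q"
proof -
  interpret P: Module.module R P by fact
  interpret M: Module.module R M by fact
  note \<phi> = mod_homD[OF assms(3)]
  have "\<phi> (p \<ominus>\<^bsub>P\<^esub> q) \<oplus>\<^bsub>M\<^esub> \<phi> q = \<phi> p"
    using assms(4,5) by (simp add: \<phi>(2)[symmetric] P.minus_eq P.a_assoc P.l_neg)
  moreover have "(\<phi> p \<ominus>\<^bsub>M\<^esub> \<phi> q) \<oplus>\<^bsub>M\<^esub> \<phi> q = \<phi> p"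
    using assms(4,5) by (simp add: \<phi>(1) M.minus_eq M.a_assoc M.l_neg)
  ultimately show ?thesis
    using assms(4,5) \<phi>(1) by (metis M.add.right_cancel M.minus_closed P.minus_closed)
qed

lemma mod_hom_comp:
  assumes "\<phi> \<in> mod_hom R P M" "\<psi> \<in> mod_hom R M Q"
  shows "(\<lambda>p. \<psi> (\<phi> p)) \<in> mod_hom R P Q"
  using assms by (auto simp: mod_hom_def Pi_iff)

lemma mod_hom_add:
  assumes "Module.module R M" "\<phi> \<in> mod_hom R P M" "\<psi> \<in> mod_hom R P M"
  shows "(\<lambda>p. \<phi> p \<oplus>\<^bsub>M\<^esub> \<psi> p) \<in> mod_hom R P M"
proof -
  interpret M: Module.module R M by fact
  show ?thesis
    using assms(2,3) by (auto simp: mod_hom_def Pi_iff M.smult_r_distr M.a_ac)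
qed

lemma mod_hom_smult:
  assumes "Module.module R M" "x \<in> carrier R"
  shows "(\<lambda>m. x \<odot>\<^bsub>M\<^esub> m) \<in> mod_hom R M M"
proof -
  interpret M: Module.module R M by fact
  have "x \<odot>\<^bsub>M\<^esub> (a \<odot>\<^bsub>M\<^esub> m) = a \<odot>\<^bsub>M\<^esub> (x \<odot>\<^bsub>M\<^esub> m)" if "a \<in> carrier R" "m \<in> carrier M" for a m
    using that assms(2) by (metis M.smult_assoc1 M.R.m_comm)
  then show ?thesis using assms(2) by (auto simp: mod_hom_def M.smult_r_distr)
qed

lemma mod_hom_diff:
  assumes "Module.module R M" "\<phi> \<in> mod_hom R P M" "\<psi> \<in> mod_hom R P M"
  shows "(\<lambda>p. \<phi> p \<ominus>\<^bsub>M\<^esub> \<psi> p) \<in> mod_hom R P M"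
proof -
  interpret M: Module.module R M by fact
  show ?thesis
    using assms(2,3)
    by (auto simp: mod_hom_def Pi_iff M.minus_eq M.minus_add M.smult_r_distr M.smult_r_minus M.a_ac)
qed

lemma mod_hom_zero_map:
  assumes "Module.module R M" shows "(\<lambda>p. \<zero>\<^bsub>M\<^esub>) \<in> mod_hom R P M"
proof -
  interpret M: Module.module R M by fact
  show ?thesis by (auto simp: mod_hom_def)
qed

lemma mod_hom_restrict:
  assumes "Module.module R P" "\<phi> \<in> mod_hom R P M"
  shows "restrict \<phi> (carrier P) \<in> mod_hom R P M"
proof -
  interpret P: Module.module R P by fact
  show ?thesis using assms(2) by (auto simp: mod_hom_def)
qed

text \<open>Free modules are projective: choose a \<open>g\<close>-preimage of
  \<open>f (e b)\<close> for each basis index and extend linearly. Asking only that \<open>f\<close>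
  land in the image of \<open>g\<close> lets \<open>g\<close> be a differential or multiplication by
  \<open>x\<close>.\<close>

lemma mod_hom_lift:
  assumes P: "Module.module R P" "is_basis R P B e"
    and X: "Module.module R X" and Y: "Module.module R Y"
    and g: "g \<in> mod_hom R X Y" and f: "f \<in> mod_hom R P Y"
    and im: "\<And>p. p \<in> carrier P \<Longrightarrow> f p \<in> g ` carrier X"
  obtains h where "h \<in> mod_hom R P X" "\<And>p. p \<in> carrier P \<Longrightarrow> g (h p) = f p"
proof -
  interpret P: Module.module R P by fact
  interpret X: Module.module R X by fact
  let ?F = "free_module R B"
  interpret F: Module.module R ?F by (rule module_free_module[OF P.is_cring])
  have e: "e \<in> B \<rightarrow> carrier P" and bij: "bij_betw (lin_comb R P e) (carrier ?F) (carrier P)"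
    using P(2) by (auto simp: is_basis_def)
  define u where "u b = inv_into (carrier X) g (f (e b))" for b
  have u: "u b \<in> carrier X" "g (u b) = f (e b)" if "b \<in> B" for b
    using im[of "e b"] e that by (auto simp: u_def inv_into_into f_inv_into_f Pi_iff)
  then have uB: "u \<in> B \<rightarrow> carrier X" by auto
  \<comment> \<open>\<open>c\<close> reads off the coordinates of an element with respect to the
    basis.\<close>
  define c where "c = inv_into (carrier ?F) (lin_comb R P e)"
  have c: "c p \<in> carrier ?F" "lin_comb R P e (c p) = p" if "p \<in> carrier P" for p
    using that bij by (auto simp: c_def bij_betw_def inv_into_into f_inv_into_f)
  have c': "c (lin_comb R P e k) = k" if "k \<in> carrier ?F" for k
    using that bij by (simp add: c_def bij_betw_def)
  note lce = mod_homD[OF lin_comb_mod_hom[OF P(1) e]]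
  have "c \<in> mod_hom R P ?F"
  proof -
    \<comment> \<open>The inverse of a linear bijection is linear: \<open>lin_comb R P e\<close>
      sends the right-hand side to the argument of \<open>c\<close> on the left, and
      \<open>c'\<close> undoes it.\<close>
    have "c (p \<oplus>\<^bsub>P\<^esub> q) = c p \<oplus>\<^bsub>?F\<^esub> c q" if "p \<in> carrier P" "q \<in> carrier P" for p q
      using c'[of "c p \<oplus>\<^bsub>?F\<^esub> c q"] that by (simp add: c lce)
    moreover have "c (a \<odot>\<^bsub>P\<^esub> p) = a \<odot>\<^bsub>?F\<^esub> c p" if "a \<in> carrier R" "p \<in> carrier P" for a p
      using c'[of "a \<odot>\<^bsub>?F\<^esub> c p"] that by (simp add: c lce)
    ultimately show ?thesis using c by (auto simp: mod_hom_def)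
  qed
  then have "(\<lambda>p. lin_comb R X u (c p)) \<in> mod_hom R P X"
    by (rule mod_hom_comp[OF _ lin_comb_mod_hom[OF X uB]])
  moreover have "g (lin_comb R X u (c p)) = f p" if p: "p \<in> carrier P" for p
  proof -
    have "g (lin_comb R X u (c p)) = lin_comb R Y (\<lambda>b. g (u b)) (c p)"
      by (rule mod_hom_lin_comb[OF X Y g uB c(1)[OF p]])
    also have "\<dots> = lin_comb R Y (\<lambda>b. f (e b)) (c p)"
    proof -
      interpret Y: Module.module R Y by fact
      note cp = free_moduleD[OF c(1)[OF p]]
      show ?thesis unfolding lin_comb_def
        by (rule Y.add.finprod_cong)
          (use cp u e mod_homD[OF f] in \<open>auto simp: Pi_iff simp_implies_def subset_iff\<close>)
    qed
    also have "\<dots> = f (lin_comb R P e (c p))"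
      by (rule mod_hom_lin_comb[OF P(1) Y f e c(1)[OF p], symmetric])
    finally show ?thesis using c(2)[OF p] by simp
  qed
  ultimately show ?thesis using that by blast
qed


section \<open>Vanishing of cohomology in terms of cochains\<close>

text \<open>
  Unlike the elements of \<open>coboundaries\<close>, cochains need not be \<open>extensional\<close> here, so that they
  can be composed and subtracted freely.
\<close>

definition null_cohomologous ::
    "('r, 'k) ring_scheme \<Rightarrow> (nat \<Rightarrow> ('r, 'p) module) \<Rightarrow> (nat \<Rightarrow> 'p \<Rightarrow> 'p) \<Rightarrow>
      ('r, 'm, 'd) module_scheme \<Rightarrow> nat \<Rightarrow> ('p \<Rightarrow> 'm) \<Rightarrow> bool"
  where "null_cohomologous R P d M i \<phi> \<longleftrightarrow>
    (case i of
      0 \<Rightarrow> \<forall>p\<in>carrier (P 0). \<phi> p = \<zero>\<^bsub>M\<^esub>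
    | Suc j \<Rightarrow> \<exists>\<psi>\<in>mod_hom R (P j) M. \<forall>p\<in>carrier (P (Suc j)). \<phi> p = \<psi> (d j p))"

text \<open>Exactness of the cochain complex in degree \<open>i\<close>. It stands in for the
  vanishing of Ext, so that the diagram chases involve no cosets.\<close>

definition acyclic_at ::
    "('r, 'k) ring_scheme \<Rightarrow> (nat \<Rightarrow> ('r, 'p) module) \<Rightarrow> (nat \<Rightarrow> 'p \<Rightarrow> 'p) \<Rightarrow>
      ('r, 'm, 'd) module_scheme \<Rightarrow> nat \<Rightarrow> bool"
  where "acyclic_at R P d M i \<longleftrightarrow>
    (\<forall>\<phi>\<in>mod_hom R (P i) M. (\<forall>p\<in>carrier (P (Suc i)). \<phi> (d i p) = \<zero>\<^bsub>M\<^esub>)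
      \<longrightarrow> null_cohomologous R P d M i \<phi>)"

section \<open>Closure properties of null-cohomologous cochains\<close>

lemma null_cohomologous_cong:
  assumes "\<And>p. p \<in> carrier (P i) \<Longrightarrow> \<phi> p = \<psi> p"
  shows "null_cohomologous R P d M i \<phi> \<longleftrightarrow> null_cohomologous R P d M i \<psi>"
  using assms by (cases i) (auto simp: null_cohomologous_def)

lemma null_cohomologous_zero:
  assumes "Module.module R M"
  shows "null_cohomologous R P d M i (\<lambda>p. \<zero>\<^bsub>M\<^esub>)"
  using mod_hom_zero_map[OF assms] by (cases i) (fastforce simp: null_cohomologous_def)+

lemma null_cohomologous_comp:
  assumes "Module.module R M" "Module.module R Q" "\<pi> \<in> mod_hom R M Q"
    "null_cohomologous R P d M i \<phi>"
  shows "null_cohomologous R P d Q i (\<lambda>p. \<pi> (\<phi> p))"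
proof (cases i)
  case 0
  then show ?thesis using assms(4) mod_hom_zero[OF assms(1-3)] by (simp add: null_cohomologous_def)
next
  case (Suc j)
  then obtain \<psi> where "\<psi> \<in> mod_hom R (P j) M" "\<forall>p\<in>carrier (P (Suc j)). \<phi> p = \<psi> (d j p)"
    using assms(4) by (auto simp: null_cohomologous_def)
  then show ?thesis
    using Suc mod_hom_comp[OF _ assms(3)]
    by (auto simp: null_cohomologous_def intro!: bexI[of _ "\<lambda>p. \<pi> (\<psi> p)"])
qed

lemma null_cohomologous_add:
  assumes "Module.module R M" "null_cohomologous R P d M i \<phi>" "null_cohomologous R P d M i \<psi>"
  shows "null_cohomologous R P d M i (\<lambda>p. \<phi> p \<oplus>\<^bsub>M\<^esub> \<psi> p)"
proof (cases i)
  case 0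
  interpret M: Module.module R M by fact
  show ?thesis using assms(2,3) 0 by (simp add: null_cohomologous_def)
next
  case (Suc j)
  then obtain \<alpha> \<beta> where "\<alpha> \<in> mod_hom R (P j) M" "\<forall>p\<in>carrier (P (Suc j)). \<phi> p = \<alpha> (d j p)"
    "\<beta> \<in> mod_hom R (P j) M" "\<forall>p\<in>carrier (P (Suc j)). \<psi> p = \<beta> (d j p)"
    using assms(2,3) by (auto simp: null_cohomologous_def)
  then show ?thesis
    using Suc mod_hom_add[OF assms(1)]
    by (auto simp: null_cohomologous_def intro!: bexI[of _ "\<lambda>p. \<alpha> p \<oplus>\<^bsub>M\<^esub> \<beta> p"])
qed

lemma null_cohomologous_diff:
  assumes "Module.module R M" "null_cohomologous R P d M i \<phi>" "null_cohomologous R P d M i \<psi>"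
  shows "null_cohomologous R P d M i (\<lambda>p. \<phi> p \<ominus>\<^bsub>M\<^esub> \<psi> p)"
proof (cases i)
  case 0
  interpret M: Module.module R M by fact
  show ?thesis using assms(2,3) 0 by (simp add: null_cohomologous_def M.minus_eq_zero_iff)
next
  case (Suc j)
  then obtain \<alpha> \<beta> where "\<alpha> \<in> mod_hom R (P j) M" "\<forall>p\<in>carrier (P (Suc j)). \<phi> p = \<alpha> (d j p)"
    "\<beta> \<in> mod_hom R (P j) M" "\<forall>p\<in>carrier (P (Suc j)). \<psi> p = \<beta> (d j p)"
    using assms(2,3) by (auto simp: null_cohomologous_def)
  then show ?thesis
    using Suc mod_hom_diff[OF assms(1)]
    by (auto simp: null_cohomologous_def intro!: bexI[of _ "\<lambda>p. \<alpha> p \<ominus>\<^bsub>M\<^esub> \<beta> p"])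
qed

text \<open>Since \<open>d j\<close> lands in \<open>carrier (P j)\<close>, restricting a primitive
  to that carrier does not affect its coboundary, so the extensional and the unrestricted notion
  agree.\<close>

lemma mem_coboundaries_iff:
  assumes "\<And>i. Module.module R (P i)" "\<And>i. d i \<in> mod_hom R (P (Suc i)) (P i)"
    "Module.module R M"
  shows "\<phi> \<in> coboundaries R P d M i \<longleftrightarrow>
    \<phi> \<in> carrier (Hom_module R (P i) M) \<and> null_cohomologous R P d M i \<phi>"
proof (cases i)
  case 0
  have "(\<lambda>p\<in>carrier (P 0). \<zero>\<^bsub>M\<^esub>) \<in> carrier (Hom_module R (P 0) M)"
  proof -
    interpret H: Module.module R "Hom_module R (P 0) M" by (rule module_Hom_module[OF assms(1,3)])
    show ?thesis using H.zero_closed by (simp add: Hom_module_def)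
  qed
  then show ?thesis
    using 0 by (auto simp: null_cohomologous_def Hom_module_def
        intro!: extensionalityI[of _ "carrier (P 0)"])
next
  case (Suc j)
  note d = mod_homD[OF assms(2)]
  show ?thesis
  proof
    assume "\<phi> \<in> coboundaries R P d M i"
    then obtain \<psi> where \<psi>: "\<psi> \<in> mod_hom R (P j) M" "\<phi> = (\<lambda>p\<in>carrier (P (Suc j)). \<psi> (d j p))"
      using Suc by (auto simp: codiff_def Hom_module_def)
    have "(\<lambda>p\<in>carrier (P (Suc j)). \<psi> (d j p)) \<in> mod_hom R (P (Suc j)) M"
      by (rule mod_hom_restrict[OF assms(1) mod_hom_comp[OF assms(2) \<psi>(1)]])
    then show "\<phi> \<in> carrier (Hom_module R (P i) M) \<and> null_cohomologous R P d M i \<phi>"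
      using Suc \<psi> by (auto simp: null_cohomologous_def Hom_module_def)
  next
    assume a: "\<phi> \<in> carrier (Hom_module R (P i) M) \<and> null_cohomologous R P d M i \<phi>"
    then obtain \<psi> where \<psi>: "\<psi> \<in> mod_hom R (P j) M" "\<forall>p\<in>carrier (P (Suc j)). \<phi> p = \<psi> (d j p)"
      using Suc by (auto simp: null_cohomologous_def)
    have "restrict \<psi> (carrier (P j)) \<in> carrier (Hom_module R (P j) M)"
      using mod_hom_restrict[OF assms(1) \<psi>(1)] by (simp add: Hom_module_def)
    moreover have "\<phi> = codiff P d j (restrict \<psi> (carrier (P j)))"
      using a \<psi>(2) Suc d(1)
      by (auto simp: codiff_def Hom_module_def intro!: extensionalityI[of _ "carrier (P (Suc j))"])
    ultimately show "\<phi> \<in> coboundaries R P d M i" using Suc by auto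
  qed
qed

lemma mem_cocycles_iff:
  "\<phi> \<in> cocycles R P d M i \<longleftrightarrow>
    \<phi> \<in> carrier (Hom_module R (P i) M) \<and> (\<forall>p\<in>carrier (P (Suc i)). \<phi> (d i p) = \<zero>\<^bsub>M\<^esub>)"
  by (auto simp: cocycles_def codiff_def Hom_module_def restrict_def fun_eq_iff)

lemma acyclic_at_iff_cocycles_subset:
  assumes "\<And>i. Module.module R (P i)" "\<And>i. d i \<in> mod_hom R (P (Suc i)) (P i)"
    "Module.module R M"
  shows "acyclic_at R P d M i \<longleftrightarrow> cocycles R P d M i \<subseteq> coboundaries R P d M i"
proof
  assume "acyclic_at R P d M i"
  then show "cocycles R P d M i \<subseteq> coboundaries R P d M i"
    by (auto simp: acyclic_at_def mem_cocycles_iff Hom_module_def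
        mem_coboundaries_iff[where P = P and d = d, OF assms])
next
  assume sub: "cocycles R P d M i \<subseteq> coboundaries R P d M i"
  show "acyclic_at R P d M i" unfolding acyclic_at_def
  proof (intro ballI impI)
    fix \<phi> assume \<phi>: "\<phi> \<in> mod_hom R (P i) M" "\<forall>p\<in>carrier (P (Suc i)). \<phi> (d i p) = \<zero>\<^bsub>M\<^esub>"
    have "restrict \<phi> (carrier (P i)) \<in> cocycles R P d M i"
      using \<phi> mod_homD(1)[OF assms(2)] mod_hom_restrict[OF assms(1)]
      by (simp add: mem_cocycles_iff Hom_module_def)
    then have "null_cohomologous R P d M i (restrict \<phi> (carrier (P i)))"
      using sub mem_coboundaries_iff[where P = P and d = d, OF assms] by blast
    then show "null_cohomologous R P d M i \<phi>"
      by (subst null_cohomologous_cong[where \<psi> = "restrict \<phi> (carrier (P i))"]) auto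
  qed
qed

text \<open>The coset of a cocycle equals the group of coboundaries exactly when the cocycle lies in
  it, so the quotient is trivial iff all cocycles are coboundaries.\<close>

lemma cohomology_trivial_iff:
  assumes "\<And>i. Module.module R (P i)" "\<And>i. d i \<in> mod_hom R (P (Suc i)) (P i)"
    "Module.module R M"
  shows "carrier (cohomology R P d M i) = {\<zero>\<^bsub>cohomology R P d M i\<^esub>} \<longleftrightarrow> acyclic_at R P d M i"
proof -
  let ?H = "Hom_module R (P i) M" and ?Z = "cocycles R P d M i" and ?B = "coboundaries R P d M i"
  interpret M: Module.module R M by fact
  interpret H: Module.module R ?H by (rule module_Hom_module[OF assms(1,3)])
  note memB = mem_coboundaries_iff[where P = P and d = d, OF assms]
  have add: "null_cohomologous R P d M i (\<phi> \<oplus>\<^bsub>?H\<^esub> \<psi>)"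
    if "null_cohomologous R P d M i \<phi>" "null_cohomologous R P d M i \<psi>" for \<phi> \<psi>
    using null_cohomologous_add[OF assms(3) that]
    by (subst null_cohomologous_cong[where \<psi> = "\<lambda>p. \<phi> p \<oplus>\<^bsub>M\<^esub> \<psi> p"]) (auto simp: Hom_module_def)
  have diff: "null_cohomologous R P d M i (\<phi> \<ominus>\<^bsub>?H\<^esub> \<psi>)"
    if \<phi>: "\<phi> \<in> carrier ?H" "null_cohomologous R P d M i \<phi>"
      and \<psi>: "\<psi> \<in> carrier ?H" "null_cohomologous R P d M i \<psi>" for \<phi> \<psi>
  proof (subst null_cohomologous_cong[where \<psi> = "\<lambda>p. \<phi> p \<ominus>\<^bsub>M\<^esub> \<psi> p"])
    fix p assume p: "p \<in> carrier (P i)"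
    have car: "\<chi> p \<in> carrier M" if "\<chi> \<in> carrier ?H" for \<chi>
      using that p by (auto simp: Hom_module_def mod_hom_def)
    \<comment> \<open>Negation in \<open>?H\<close> is known only through the group laws, so the
      value of the difference at \<open>p\<close> is found by adding \<open>\<psi>\<close> back and
      cancelling \<open>\<psi> p\<close> in \<open>M\<close>.\<close>
    have "(\<phi> \<ominus>\<^bsub>?H\<^esub> \<psi>) \<oplus>\<^bsub>?H\<^esub> \<psi> = \<phi>"
      using \<phi> \<psi> by (simp add: H.minus_eq H.a_assoc H.l_neg)
    then have "(\<phi> \<ominus>\<^bsub>?H\<^esub> \<psi>) p \<oplus>\<^bsub>M\<^esub> \<psi> p = \<phi> p"
      using p by (auto simp: Hom_module_def fun_eq_iff restrict_def split: if_splits)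
    moreover have "(\<phi> p \<ominus>\<^bsub>M\<^esub> \<psi> p) \<oplus>\<^bsub>M\<^esub> \<psi> p = \<phi> p"
      using car \<phi> \<psi> by (simp add: M.minus_eq M.a_assoc M.l_neg)
    ultimately show "(\<phi> \<ominus>\<^bsub>?H\<^esub> \<psi>) p = \<phi> p \<ominus>\<^bsub>M\<^esub> \<psi> p"
      using car \<phi> \<psi> by (metis H.minus_closed M.add.right_cancel M.minus_closed)
  qed (rule null_cohomologous_diff[OF assms(3) \<phi>(2) \<psi>(2)])
  have "null_cohomologous R P d M i \<zero>\<^bsub>?H\<^esub>"
    using null_cohomologous_zero[OF assms(3)]
    by (subst null_cohomologous_cong[where \<psi> = "\<lambda>p. \<zero>\<^bsub>M\<^esub>"]) (auto simp: Hom_module_def)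
  then have zeroB: "\<zero>\<^bsub>?H\<^esub> \<in> ?B" by (simp add: memB)
  have zeroZ: "\<zero>\<^bsub>?H\<^esub> \<in> ?Z"
    using H.zero_closed mod_homD(1)[OF assms(2)] by (auto simp: mem_cocycles_iff Hom_module_def)
  \<comment> \<open>\<open>K z\<close> is the coset of \<open>z\<close> modulo the coboundaries,
    spelled out so that the record with altered carrier in \<open>cohomology\<close>
    disappears.\<close>
  define K where "K z = (\<lambda>b. b \<oplus>\<^bsub>?H\<^esub> z) ` ?B" for z
  have K: "K z = ?B \<longleftrightarrow> z \<in> ?B" if z: "z \<in> ?Z" for z
  proof
    have zH: "z \<in> carrier ?H" using z by (simp add: mem_cocycles_iff)
    show "z \<in> ?B" if "K z = ?B"
      using zeroB H.l_zero[OF zH] that unfolding K_def by (metis image_eqI)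
    show "K z = ?B" if zB: "z \<in> ?B"
    proof (intro equalityI subsetI)
      fix b assume "b \<in> K z"
      then show "b \<in> ?B" using zB add by (auto simp: K_def memB)
    next
      fix b assume b: "b \<in> ?B"
      then have "b \<ominus>\<^bsub>?H\<^esub> z \<in> ?B" using zB diff by (auto simp: memB)
      moreover have "b = (b \<ominus>\<^bsub>?H\<^esub> z) \<oplus>\<^bsub>?H\<^esub> z"
        using b zH by (simp add: memB H.minus_eq H.a_assoc H.l_neg)
      ultimately show "b \<in> K z" unfolding K_def by blast
    qed
  qed
  have "carrier (cohomology R P d M i) = K ` ?Z"
    by (auto simp: cohomology_def quotient_module_def A_RCOSETS_def' a_r_coset_def' K_def image_def)
  moreover have "\<zero>\<^bsub>cohomology R P d M i\<^esub> = ?B"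
    by (simp add: cohomology_def quotient_module_def)
  moreover have "K ` ?Z = {?B} \<longleftrightarrow> ?Z \<subseteq> ?B"
  proof -
    \<comment> \<open>\<open>zeroZ\<close> makes the set of cosets nonempty, so containment in the
      singleton is already equality.\<close>
    have "K ` ?Z = {?B} \<longleftrightarrow> (\<forall>z\<in>?Z. K z = ?B)" 
      using zeroZ subset_singleton_iff[of "K ` ?Z" ?B] unfolding image_subset_iff
      by (auto simp only: image_is_empty singleton_iff)
    then show ?thesis using K by (simp add: subset_iff Ball_def)
  qed
  ultimately show ?thesis
    using acyclic_at_iff_cocycles_subset[where P = P and d = d, OF assms] by simp
qed


section \<open>Cohomology with coefficients in the quotient by a regular element\<close>

text \<open>The quotient \<open>M / x M\<close> enters only through its projection \<open>\<pi> : M \<rightarrow> Q\<close>.\<close>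

locale resolution_regular_quotient =
  fixes R :: "('r, 'k) ring_scheme" and N :: "('r, 'n, 'c) module_scheme"
    and P :: "nat \<Rightarrow> ('r, 'p) module" and d \<epsilon> and B :: "nat \<Rightarrow> 'b set" and e
    and M :: "('r, 'm, 'd) module_scheme" and Q :: "('r, 'q, 'f) module_scheme"
    and \<pi> :: "'m \<Rightarrow> 'q" and x :: 'r
  assumes N: "Module.module R N" and M: "Module.module R M" and Q: "Module.module R Q"
    and res: "free_resolution R N P d \<epsilon> B e"
    and ann: "x \<in> annihilator R N" and reg: "regular_elt R M x"
    and \<pi>: "\<pi> \<in> mod_hom R M Q" and \<pi>_surj: "\<pi> ` carrier M = carrier Q"
    and \<pi>_ker: "\<And>m. m \<in> carrier M \<Longrightarrow> \<pi> m = \<zero>\<^bsub>Q\<^esub> \<longleftrightarrow> m \<in> smult_image x M"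
begin

section \<open>Consequences of exactness, regularity and annihilation\<close>

sublocale M: Module.module R M by (rule M)
sublocale Q: Module.module R Q by (rule Q)

lemma P: "Module.module R (P i)" and basis: "is_basis R (P i) (B i) (e i)"
  using res by (auto simp: free_resolution_def)

sublocale P: Module.module R "P i" for i by (rule P)

lemma d: "d i \<in> mod_hom R (P (Suc i)) (P i)"
  and \<epsilon>: "\<epsilon> \<in> mod_hom R (P 0) N"
  and exact0: "p \<in> carrier (P 0) \<Longrightarrow> \<epsilon> p = \<zero>\<^bsub>N\<^esub> \<Longrightarrow> p \<in> d 0 ` carrier (P (Suc 0))"
  and exact: "q \<in> carrier (P (Suc i)) \<Longrightarrow> d i q = \<zero>\<^bsub>P i\<^esub> \<Longrightarrow> q \<in> d (Suc i) ` carrier (P (Suc (Suc i)))"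
  and d_d: "r \<in> carrier (P (Suc (Suc i))) \<Longrightarrow> d i (d (Suc i) r) = \<zero>\<^bsub>P i\<^esub>"
  using res unfolding free_resolution_def by (auto, blast+)

lemmas d_simps [simp] = mod_homD[OF d]

lemma x: "x \<in> carrier R"
  and x_inj: "m \<in> carrier M \<Longrightarrow> m' \<in> carrier M \<Longrightarrow> x \<odot>\<^bsub>M\<^esub> m = x \<odot>\<^bsub>M\<^esub> m' \<Longrightarrow> m = m'"
  using reg by (auto simp: regular_elt_def inj_on_def)

lemma x_eq_zero: "m \<in> carrier M \<Longrightarrow> x \<odot>\<^bsub>M\<^esub> m = \<zero>\<^bsub>M\<^esub> \<Longrightarrow> m = \<zero>\<^bsub>M\<^esub>"
  by (rule x_inj) (auto simp: x)

text \<open>As \<open>x\<close> kills \<open>N\<close>, \<open>\<epsilon>\<close> kills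
  \<open>x p\<close>, and exactness at \<open>P 0\<close> applies.\<close>

lemma x_in_image_d:
  assumes "p \<in> carrier (P 0)" shows "x \<odot>\<^bsub>P 0\<^esub> p \<in> d 0 ` carrier (P (Suc 0))"
  by (rule exact0)
    (use assms ann x mod_homD[OF \<epsilon>] in \<open>auto simp: annihilator_def\<close>)

lemma coboundary_cocycle:
  assumes "null_cohomologous R P d A i \<phi>" "Module.module R A" "p \<in> carrier (P (Suc i))"
  shows "\<phi> (d i p) = \<zero>\<^bsub>A\<^esub>"
proof (cases i)
  case 0
  then show ?thesis using assms by (auto simp: null_cohomologous_def)
next
  case (Suc j)
  then obtain \<psi> where "\<psi> \<in> mod_hom R (P j) A" "\<forall>p\<in>carrier (P (Suc j)). \<phi> p = \<psi> (d j p)"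
    using assms by (auto simp: null_cohomologous_def)
  then show ?thesis using Suc assms mod_hom_zero[OF P assms(2)] by (simp add: d_d)
qed

text \<open>
  The part of the null-homotopy of \<open>x\<close> that matters: \<open>q \<mapsto> x q - h (d q)\<close> takes values in cycles.
  Carrying just this property through the induction avoids choosing all \<open>h\<close> simultaneously.
\<close>

lemma homotopy:
  "\<exists>h\<in>mod_hom R (P i) (P (Suc i)). \<forall>q\<in>carrier (P (Suc i)). d i (h (d i q)) = x \<odot>\<^bsub>P i\<^esub> d i q"
proof (induction i)
  case 0
  \<comment> \<open>In degree 0 all of \<open>x p\<close> is a boundary, so multiplication by
    \<open>x\<close> itself lifts through \<open>d 0\<close>.\<close>
  obtain h where "h \<in> mod_hom R (P 0) (P (Suc 0))"
    "\<And>p. p \<in> carrier (P 0) \<Longrightarrow> d 0 (h p) = x \<odot>\<^bsub>P 0\<^esub> p"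
    using mod_hom_lift[OF P basis P P d mod_hom_smult[OF P x] x_in_image_d] by blast
  then show ?case using d_simps(1) by blast
next
  case (Suc i)
  then obtain h where h: "h \<in> mod_hom R (P i) (P (Suc i))"
    "\<And>q. q \<in> carrier (P (Suc i)) \<Longrightarrow> d i (h (d i q)) = x \<odot>\<^bsub>P i\<^esub> d i q" by blast
  \<comment> \<open>By the induction hypothesis \<open>?f\<close>, that is x - h d, takes values in
    cycles, hence in boundaries; lifting it through \<open>d (Suc i)\<close> gives the next map
    \<open>k\<close>.\<close>
  let ?f = "\<lambda>q. x \<odot>\<^bsub>P (Suc i)\<^esub> q \<ominus>\<^bsub>P (Suc i)\<^esub> h (d i q)"
  have f: "?f \<in> mod_hom R (P (Suc i)) (P (Suc i))"
    by (rule mod_hom_diff[OF P mod_hom_smult[OF P x] mod_hom_comp[OF d h(1)]])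
  have "?f q \<in> d (Suc i) ` carrier (P (Suc (Suc i)))" if q: "q \<in> carrier (P (Suc i))" for q
  proof (rule exact)
    show "d i (?f q) = \<zero>\<^bsub>P i\<^esub>"
      using q mod_homD(1)[OF h(1)] x by (simp add: mod_hom_minus[OF P P d] h(2) P.minus_eq_zero_iff)
  qed (rule mod_homD(1)[OF f q])
  then obtain k where k: "k \<in> mod_hom R (P (Suc i)) (P (Suc (Suc i)))"
    "\<And>q. q \<in> carrier (P (Suc i)) \<Longrightarrow> d (Suc i) (k q) = ?f q"
    using mod_hom_lift[OF P basis P P d f] by blast
  \<comment> \<open>On boundaries the term with \<open>h\<close> drops out because d d = 0.\<close>
  have "d (Suc i) (k (d (Suc i) r)) = x \<odot>\<^bsub>P (Suc i)\<^esub> d (Suc i) r"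
    if "r \<in> carrier (P (Suc (Suc i)))" for r
    using that x by (simp add: k(2) d_d mod_hom_zero[OF P P h(1)] P.minus_eq)
  then show ?case using k(1) by blast
qed

text \<open>This says that \<open>x\<close> kills Ext in degree i + 1. With \<open>h\<close> from
  \<open>homotopy\<close>, x q - h (d q) is a boundary and so is killed by \<open>\<theta>\<close>;
  hence \<open>\<theta>\<close> composed with \<open>h\<close> is a primitive of x
  \<open>\<theta>\<close>.\<close>

lemma x_kills_cocycle:
  assumes \<theta>: "\<theta> \<in> mod_hom R (P (Suc i)) M"
    and coc: "\<And>r. r \<in> carrier (P (Suc (Suc i))) \<Longrightarrow> \<theta> (d (Suc i) r) = \<zero>\<^bsub>M\<^esub>"
  obtains \<phi> where "\<phi> \<in> mod_hom R (P i) M"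
    "\<And>q. q \<in> carrier (P (Suc i)) \<Longrightarrow> \<phi> (d i q) = x \<odot>\<^bsub>M\<^esub> \<theta> q"
proof -
  obtain h where h: "h \<in> mod_hom R (P i) (P (Suc i))"
    "\<And>q. q \<in> carrier (P (Suc i)) \<Longrightarrow> d i (h (d i q)) = x \<odot>\<^bsub>P i\<^esub> d i q"
    using homotopy by blast
  have "\<theta> (h (d i q)) = x \<odot>\<^bsub>M\<^esub> \<theta> q" if q: "q \<in> carrier (P (Suc i))" for q
  proof -
    have hq: "h (d i q) \<in> carrier (P (Suc i))" using q mod_homD(1)[OF h(1)] by simp
    have "x \<odot>\<^bsub>P (Suc i)\<^esub> q \<ominus>\<^bsub>P (Suc i)\<^esub> h (d i q) \<in> d (Suc i) ` carrier (P (Suc (Suc i)))"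
      by (rule exact) (use q hq x in \<open>auto simp: mod_hom_minus[OF P P d] h(2) P.minus_eq_zero_iff\<close>)
    then have "\<theta> (x \<odot>\<^bsub>P (Suc i)\<^esub> q \<ominus>\<^bsub>P (Suc i)\<^esub> h (d i q)) = \<zero>\<^bsub>M\<^esub>" using coc by auto
    then show ?thesis
      using q hq x mod_homD[OF \<theta>] by (simp add: mod_hom_minus[OF P M \<theta>] M.minus_eq_zero_iff)
  qed
  then show ?thesis using that mod_hom_comp[OF h(1) \<theta>] by blast
qed

section \<open>Moving cochains along 0 -> M -> M -> Q -> 0\<close>

lemma lift_to_M:
  assumes "\<psi> \<in> mod_hom R (P i) Q"
  obtains \<phi> where "\<phi> \<in> mod_hom R (P i) M" "\<And>p. p \<in> carrier (P i) \<Longrightarrow> \<pi> (\<phi> p) = \<psi> p"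
proof -
  have "\<psi> p \<in> \<pi> ` carrier M" if "p \<in> carrier (P i)" for p
    using mod_homD(1)[OF assms that] \<pi>_surj by simp
  then show ?thesis using mod_hom_lift[OF P basis M Q \<pi> assms] that by blast
qed

text \<open>Such a cochain takes values in x M, the kernel of \<open>\<pi>\<close>, so projectivity
  of \<open>P i\<close> lifts it through multiplication by \<open>x\<close>.\<close>

lemma divide_by_x:
  assumes "\<phi> \<in> mod_hom R (P i) M" "\<And>p. p \<in> carrier (P i) \<Longrightarrow> \<pi> (\<phi> p) = \<zero>\<^bsub>Q\<^esub>"
  obtains \<rho> where "\<rho> \<in> mod_hom R (P i) M" "\<And>p. p \<in> carrier (P i) \<Longrightarrow> x \<odot>\<^bsub>M\<^esub> \<rho> p = \<phi> p"
proof -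
  have "\<phi> p \<in> (\<lambda>m. x \<odot>\<^bsub>M\<^esub> m) ` carrier M" if "p \<in> carrier (P i)" for p
    using \<pi>_ker[OF mod_homD(1)[OF assms(1) that]] assms(2)[OF that] by (simp add: smult_image_def)
  then show ?thesis using mod_hom_lift[OF P basis M M mod_hom_smult[OF M x] assms(1)] that by blast
qed

text \<open>Lift a primitive from \<open>Q\<close> to \<open>M\<close> and apply the codifferential;
  in degree 0 the zero cochain serves.\<close>

lemma lift_coboundary:
  assumes "null_cohomologous R P d Q i \<psi>"
  obtains \<beta> where "\<beta> \<in> mod_hom R (P i) M" "null_cohomologous R P d M i \<beta>"
    "\<And>p. p \<in> carrier (P i) \<Longrightarrow> \<pi> (\<beta> p) = \<psi> p"
proof (cases i)
  case 0
  then show ?thesis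
    using assms that[OF mod_hom_zero_map[OF M]] mod_hom_zero[OF M Q \<pi>]
    by (simp add: null_cohomologous_def)
next
  case (Suc j)
  then obtain \<tau> where \<tau>: "\<tau> \<in> mod_hom R (P j) Q" "\<forall>p\<in>carrier (P (Suc j)). \<psi> p = \<tau> (d j p)"
    using assms by (auto simp: null_cohomologous_def)
  obtain \<sigma> where \<sigma>: "\<sigma> \<in> mod_hom R (P j) M" "\<And>p. p \<in> carrier (P j) \<Longrightarrow> \<pi> (\<sigma> p) = \<tau> p"
    using lift_to_M[OF \<tau>(1)] by blast
  show ?thesis
    by (rule that[of "\<lambda>p. \<sigma> (d j p)"])
      (use Suc \<sigma> \<tau> mod_hom_comp[OF d \<sigma>(1)] in \<open>auto simp: null_cohomologous_def\<close>)
qed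

text \<open>In effect Hom(N, M) = 0: a cocycle vanishes on boundaries, among them x p, so x
  \<open>\<phi>\<close> p = 0 and regularity gives \<open>\<phi>\<close> p = 0.\<close>

lemma acyclic_at_0: "acyclic_at R P d M 0"
  unfolding acyclic_at_def null_cohomologous_def
proof (clarsimp)
  fix \<phi> p assume \<phi>: "\<phi> \<in> mod_hom R (P 0) M" "\<forall>p\<in>carrier (P (Suc 0)). \<phi> (d 0 p) = \<zero>\<^bsub>M\<^esub>"
    and p: "p \<in> carrier (P 0)"
  have "x \<odot>\<^bsub>M\<^esub> \<phi> p = \<zero>\<^bsub>M\<^esub>"
    using x_in_image_d[OF p] \<phi>(2) mod_homD(3)[OF \<phi>(1) x p] by auto
  then show "\<phi> p = \<zero>\<^bsub>M\<^esub>" using x_eq_zero mod_homD(1)[OF \<phi>(1) p] by blast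
qed

text \<open>Exactness of Ext i (N, M) -> Ext i (N, Q) -> Ext (i + 1) (N, M) at the middle term,
  chased by hand when both outer terms vanish.\<close>

lemma acyclic_at_quotient:
  assumes "acyclic_at R P d M i" "acyclic_at R P d M (Suc i)"
  shows "acyclic_at R P d Q i"
  unfolding acyclic_at_def
proof (intro ballI impI)
  fix \<psi> assume \<psi>: "\<psi> \<in> mod_hom R (P i) Q" and coc: "\<forall>p\<in>carrier (P (Suc i)). \<psi> (d i p) = \<zero>\<^bsub>Q\<^esub>"
  obtain \<phi> where \<phi>: "\<phi> \<in> mod_hom R (P i) M" "\<And>p. p \<in> carrier (P i) \<Longrightarrow> \<pi> (\<phi> p) = \<psi> p"
    using lift_to_M[OF \<psi>] by blast
  have "\<pi> (\<phi> (d i p)) = \<zero>\<^bsub>Q\<^esub>" if "p \<in> carrier (P (Suc i))" for p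
    using that coc by (simp add: \<phi>(2))
  \<comment> \<open>\<open>\<theta>\<close> represents the image of \<open>\<psi>\<close> under the
    connecting homomorphism.\<close>
  then obtain \<theta> where \<theta>: "\<theta> \<in> mod_hom R (P (Suc i)) M"
    "\<And>p. p \<in> carrier (P (Suc i)) \<Longrightarrow> x \<odot>\<^bsub>M\<^esub> \<theta> p = \<phi> (d i p)"
    using divide_by_x[OF mod_hom_comp[OF d \<phi>(1)]] by blast
  \<comment> \<open>Multiplying by \<open>x\<close> turns the left side into \<open>\<phi>\<close>
    applied to d d r, which is zero; then cancel \<open>x\<close>.\<close>
  have "\<theta> (d (Suc i) r) = \<zero>\<^bsub>M\<^esub>" if "r \<in> carrier (P (Suc (Suc i)))" for r
    using that mod_homD(1)[OF \<theta>(1)] mod_hom_zero[OF P M \<phi>(1)]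
    by - (rule x_eq_zero, simp_all add: \<theta>(2) d_d)
  then have "null_cohomologous R P d M (Suc i) \<theta>"
    using assms(2) \<theta>(1) by (simp add: acyclic_at_def)
  then obtain \<rho> where \<rho>: "\<rho> \<in> mod_hom R (P i) M" "\<And>p. p \<in> carrier (P (Suc i)) \<Longrightarrow> \<theta> p = \<rho> (d i p)"
    by (auto simp: null_cohomologous_def)
  \<comment> \<open>Subtracting x \<open>\<rho>\<close> makes the lift of \<open>\<psi>\<close> a
    cocycle without changing its image in \<open>Q\<close>.\<close>
  let ?\<delta> = "\<lambda>p. \<phi> p \<ominus>\<^bsub>M\<^esub> x \<odot>\<^bsub>M\<^esub> \<rho> p"
  have "?\<delta> \<in> mod_hom R (P i) M"
    by (rule mod_hom_diff[OF M \<phi>(1) mod_hom_comp[OF \<rho>(1) mod_hom_smult[OF M x]]])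
  moreover have "?\<delta> (d i p) = \<zero>\<^bsub>M\<^esub>" if "p \<in> carrier (P (Suc i))" for p
    using that mod_homD(1)[OF \<phi>(1)] by (simp add: \<theta>(2) \<rho>(2)[symmetric] M.minus_eq_zero_iff)
  ultimately have "null_cohomologous R P d M i ?\<delta>" using assms(1) by (simp add: acyclic_at_def)
  then have "null_cohomologous R P d Q i (\<lambda>p. \<pi> (?\<delta> p))"
    by (rule null_cohomologous_comp[OF M Q \<pi>])
  moreover have "\<pi> (?\<delta> p) = \<psi> p" if p: "p \<in> carrier (P i)" for p
  proof -
    have "\<pi> (x \<odot>\<^bsub>M\<^esub> \<rho> p) = \<zero>\<^bsub>Q\<^esub>"
      using \<pi>_ker[of "x \<odot>\<^bsub>M\<^esub> \<rho> p"] mod_homD(1)[OF \<rho>(1) p] x by (auto simp: smult_image_def)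
    then show ?thesis
      using p x mod_homD(1)[OF \<phi>(1)] mod_homD(1)[OF \<rho>(1)] mod_homD(1)[OF \<psi>]
      by (simp add: mod_hom_minus[OF M Q \<pi>] \<phi>(2) Q.minus_eq)
  qed
  ultimately show "null_cohomologous R P d Q i \<psi>"
    by (subst null_cohomologous_cong[where \<psi> = "\<lambda>p. \<pi> (?\<delta> p)"]) auto
qed

text \<open>Write x \<open>\<theta>\<close> as the coboundary of \<open>\<phi>\<close>. Modulo x M,
  \<open>\<phi>\<close> is a cocycle, hence a coboundary, which lifts to a coboundary
  \<open>\<beta>\<close> over \<open>M\<close>. Then \<open>\<phi>\<close> - \<open>\<beta>\<close>
  = x \<open>\<rho>\<close> has the same coboundary x \<open>\<theta>\<close>, and cancelling
  \<open>x\<close> makes \<open>\<rho>\<close> a primitive of \<open>\<theta>\<close>.\<close>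

lemma acyclic_at_Suc:
  assumes "acyclic_at R P d Q i" shows "acyclic_at R P d M (Suc i)"
  unfolding acyclic_at_def
proof (intro ballI impI)
  fix \<theta> assume \<theta>: "\<theta> \<in> mod_hom R (P (Suc i)) M"
    and coc: "\<forall>r\<in>carrier (P (Suc (Suc i))). \<theta> (d (Suc i) r) = \<zero>\<^bsub>M\<^esub>"
  obtain \<phi> where \<phi>: "\<phi> \<in> mod_hom R (P i) M"
    "\<And>q. q \<in> carrier (P (Suc i)) \<Longrightarrow> \<phi> (d i q) = x \<odot>\<^bsub>M\<^esub> \<theta> q"
    using x_kills_cocycle[OF \<theta>] coc by blast
  have "\<pi> (\<phi> (d i q)) = \<zero>\<^bsub>Q\<^esub>" if q: "q \<in> carrier (P (Suc i))" for q
    using \<pi>_ker[of "x \<odot>\<^bsub>M\<^esub> \<theta> q"] mod_homD(1)[OF \<theta> q] x by (auto simp: \<phi>(2)[OF q] smult_image_def)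
  then have "null_cohomologous R P d Q i (\<lambda>p. \<pi> (\<phi> p))"
    using assms mod_hom_comp[OF \<phi>(1) \<pi>] by (simp add: acyclic_at_def)
  then obtain \<beta> where \<beta>: "\<beta> \<in> mod_hom R (P i) M" "null_cohomologous R P d M i \<beta>"
    "\<And>p. p \<in> carrier (P i) \<Longrightarrow> \<pi> (\<beta> p) = \<pi> (\<phi> p)"
    using lift_coboundary by blast
  have "\<pi> (\<phi> p \<ominus>\<^bsub>M\<^esub> \<beta> p) = \<zero>\<^bsub>Q\<^esub>" if "p \<in> carrier (P i)" for p
    using that mod_homD(1)[OF \<phi>(1)] mod_homD(1)[OF \<beta>(1)] mod_homD(1)[OF \<pi>]
    by (simp add: mod_hom_minus[OF M Q \<pi>] \<beta>(3) Q.minus_eq_zero_iff)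
  then obtain \<rho> where \<rho>: "\<rho> \<in> mod_hom R (P i) M"
    "\<And>p. p \<in> carrier (P i) \<Longrightarrow> x \<odot>\<^bsub>M\<^esub> \<rho> p = \<phi> p \<ominus>\<^bsub>M\<^esub> \<beta> p"
    using divide_by_x[OF mod_hom_diff[OF M \<phi>(1) \<beta>(1)]] by blast
  have "\<theta> q = \<rho> (d i q)" if q: "q \<in> carrier (P (Suc i))" for q
    using q x mod_homD(1)[OF \<theta> q] mod_homD(1)[OF \<rho>(1)]
    by - (rule x_inj, simp_all add: \<rho>(2) \<phi>(2) coboundary_cocycle[OF \<beta>(2) M] M.minus_eq)
  then show "null_cohomologous R P d M (Suc i) \<theta>"
    using \<rho>(1) by (auto simp: null_cohomologous_def)
qed

end


section \<open>The depth formula\<close>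

lemma quotient_module_add: "X \<oplus>\<^bsub>quotient_module M H\<^esub> Y = X <+>\<^bsub>M\<^esub> Y"
  by (simp add: quotient_module_def)

lemma quotient_projection:
  assumes "Module.module R M" "submodule H R M"
  shows "(\<lambda>m. H +>\<^bsub>M\<^esub> m) \<in> mod_hom R M (quotient_module M H)"
    and "(\<lambda>m. H +>\<^bsub>M\<^esub> m) ` carrier M = carrier (quotient_module M H)"
    and "m \<in> carrier M \<Longrightarrow> H +>\<^bsub>M\<^esub> m = \<zero>\<^bsub>quotient_module M H\<^esub> \<longleftrightarrow> m \<in> H"
proof -
  interpret Module.module R M by fact
  interpret H: submodule H R M by fact
  have sub: "subgroup H (add_monoid M)" by (rule H.subgroup_axioms)
  interpret S: abelian_subgroup H M
    by (rule abelian_subgroupI3)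
      (use sub in \<open>auto simp: additive_subgroup_def intro: abelian_group_axioms\<close>)
  show im: "(\<lambda>m. H +>\<^bsub>M\<^esub> m) ` carrier M = carrier (quotient_module M H)"
    by (auto simp: quotient_module_def A_RCOSETS_def')
  show "(\<lambda>m. H +>\<^bsub>M\<^esub> m) \<in> mod_hom R M (quotient_module M H)"
    using im quotient_smult_coset[OF assms] S.a_rcos_sum
    by (auto simp: mod_hom_def quotient_module_add)
  show "H +>\<^bsub>M\<^esub> m = \<zero>\<^bsub>quotient_module M H\<^esub> \<longleftrightarrow> m \<in> H" if "m \<in> carrier M"
    using S.a_rcos_self[OF that] S.a_rcos_const by (auto simp: quotient_module_def)
qed

text \<open>\<open>U\<close> and \<open>V\<close> stand for non-vanishing of Ext with coefficients
  in the quotient and in \<open>M\<close>. The least \<open>V\<close>-index is some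
  \<open>Suc k\<close>; then \<open>U k\<close> holds, and a smaller \<open>U\<close>-index would
  yield a smaller \<open>V\<close>-index.\<close>

lemma enat_Least_shift:
  assumes "\<not> V 0" "\<And>i. V (Suc i) \<Longrightarrow> U i" "\<And>i. U i \<Longrightarrow> V i \<or> V (Suc i)"
  shows "(if \<exists>i. U i then enat (LEAST i. U i) else \<infinity>) + 1 =
    (if \<exists>i. V i then enat (LEAST i. V i) else \<infinity>)"
proof (cases "\<exists>i. V i")
  case True
  define m where "m = (LEAST i. V i)"
  have "V m" using True unfolding m_def by (auto intro: LeastI)
  then obtain k where k: "m = Suc k" using assms(1) by (cases m) auto
  have "U k" using assms(2) \<open>V m\<close> k by blast
  moreover have "k \<le> j" if "U j" for j
  proof -
    have "m \<le> Suc j" using assms(3)[OF that] by (auto simp: m_def intro: Least_le le_SucI)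
    then show ?thesis using k by simp
  qed
  ultimately have "(LEAST i. U i) = k" by (rule Least_equality)
  then show ?thesis
    using True \<open>U k\<close> k m_def[symmetric] by (auto simp: one_enat_def)
next
  case False
  then have "\<nexists>i. U i" using assms(3) by blast
  then show ?thesis using False by simp
qed

theorem proposition1p6:
  fixes R :: "('r, 'k) ring_scheme"
    and M :: "('r, 'm, 'c) module_scheme"
    and N :: "('r, 'n, 'd) module_scheme"
    and x :: 'r
  assumes "cring R" and "Module.module R M" and "Module.module R N"
    and "x \<in> annihilator R N"
    and "regular_elt R M x"
  shows "depth R N (quotient_module M (smult_image x M)) + 1 = depth R N M"
proof -
  let ?Q = "quotient_module M (smult_image x M)"
  have sub: "submodule (smult_image x M) R M"
    using submodule_smult_image[OF assms(2)] assms(5) by (simp add: regular_elt_def)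
  note Q = module_quotient_module[OF assms(2) sub]
  \<comment> \<open>The chases apply to the resolution that defines \<open>Ext\<close>, with the
    coset map as \<open>\<pi>\<close>.\<close>
  interpret resolution_regular_quotient R N "std_res R N" "std_res_d R N" "std_res_aug R N"
    "std_res_gens R N" "\<lambda>_. free_gen R" M ?Q "\<lambda>m. smult_image x M +>\<^bsub>M\<^esub> m" x
    by (rule resolution_regular_quotient.intro)
      (rule assms Q free_resolution_std_res quotient_projection[OF assms(2) sub] | assumption)+
  have Ext: "carrier (Ext R N A i) = {\<zero>\<^bsub>Ext R N A i\<^esub>} \<longleftrightarrow> acyclic_at R (std_res R N) (std_res_d R N) A i"
    if "Module.module R A" for A :: "('r, 'a, 'e) module_scheme" and i
    unfolding Ext_def by (rule cohomology_trivial_iff[where P = "std_res R N" and d = "std_res_d R N", OF P d that])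
  \<comment> \<open>The premises of \<open>enat_Least_shift\<close> are \<open>acyclic_at_0\<close>
    and the contrapositives of \<open>acyclic_at_Suc\<close> and
    \<open>acyclic_at_quotient\<close>.\<close>
  show ?thesis
    unfolding depth_def Ext[OF Q] Ext[OF assms(2)]
    by (rule enat_Least_shift) (use acyclic_at_0 acyclic_at_quotient acyclic_at_Suc in blast)+
qed

end
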